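(* Let $S=S_2\circ S_1$ for mappings $S_1:\mathbb{R}^n\rightrightarrows\mathbb{R}^p$ and $S_2:\mathbb{R}^p\rightrightarrows\mathbb{R}^m$. Let $X\subseteq\mathbb{R}^n$ be a closed set with $\bar{x}\in X$. Let $S_1$ be outer semicontinuous relative to $X$ and let $S_2$ be outer semicontinuous. For a pair $(\bar{x},\bar{u})\in\operatorname{gph}S|_X=\operatorname{gph}(S_2\circ S_1|_X)$, assume: (a) the mapping $(x,u)\mapsto S_1|_X(x)\cap S_2^{-1}(u)$ is locally bounded at $(\bar{x},\bar{u})$, or equivalently, the mapping $(x,u)\mapsto S_1(x)\cap S_2^{-1}(u)$ is locally bounded relative to $X\times\mathbb{R}^m$ at $(\bar{x},\bar{u})$ (this being true in particular if either $S_1$ is locally bounded relative to $X$ at $\bar{x}$ or $S_2^{-1}$ is locally bounded at $\bar{u}$). In this way, $S_2\circ S_1|_X$ is outer semicontinuous. (b) $D^*S_2(\bar{w}\mid\bar{u})(0)\cap D^*_XS_1(\bar{x}\mid\bar{w})^{-1}(0)=\{0\}$ holds for any $\bar{w}\in S_1|_X(\bar{x})\cap S_2^{-1}(\bar{u})$ (this being true in particular if $S_2$ has the Lipschitz-like property at $\bar{w}$ for $\bar{u}$). Then $\operatorname{gph}S|_X$ is locally closed around $(\bar{x},\bar{u})$ and $$D^*_XS(\bar{x}\mid\bar{u})\subset\bigcup_{\bar{w}\in S_1|_X(\bar{x})\cap S_2^{-1}(\bar{u})}D^*_XS_1(\bar{x}\mid\bar{w})\circ D^*S_2(\bar{w}\mid\bar{u}).$$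 Besides, if (a) and (b) hold, $S_1|_X$ and $S_2$ are graph-convex and $X$ is a smooth manifold around $\bar{x}$, then $S|_X$ is graph-convex as well and $$D^*_XS(\bar{x}\mid\bar{u})=D^*_XS_1(\bar{x}\mid\bar{w})\circ D^*S_2(\bar{w}\mid\bar{u})\qquad\forall\,\bar{w}\in S_1|_X(\bar{x})\cap S_2^{-1}(\bar{u}).$$
   Context: For $C\subseteq\mathbb{R}^n$ and $x\in C$: $T_C(x)=\limsup_{t\searrow 0}\frac{C-x}{t}$ (outer limit) is the tangent (contingent) cone; the regular normal cone is $\widehat{N}_C(x)=\{v\mid \limsup_{x'\to x,\,x'\in C,\,x'\neq x}\langle v,x'-x\rangle/\|x'-x\|\le 0\}$; the limiting normal cone $N_C(x)$ is the set of $v$ for which there are $x_k\to x$, $x_k\in C$, and $v_k\to v$ with $v_k\in\widehat{N}_C(x_k)$. These are empty for $x\notin C$. $C$ is locally closed at $x\in C$ if $C\cap U$ is closed for some closed neighborhood $U$ of $x$. $\operatorname{proj}_C(x)=\{y\in C\mid\|y-x\|=d(x,C)\}$, where $d(x,C)$ is the distance from $x$ to $C$, and $\operatorname{proj}_CA=\bigcup_{a\in A}\operatorname{proj}_C(a)$. For a set-valued mapping $S$, $\operatorname{gph}S=\{(x,u)\mid u\in S(x)\}$; $S|_X$ equals $S(x)$ for $x\in X$ and $\emptyset$ for $x\notin X$; $S^{-1}(u)=\{x\mid u\in S(x)\}$; $(A\circ B)(y)=\bigcup_{z\in B(y)}A(z)$; inclusions and unions of mappings are understood argumentwise (equivalently,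 for graphs). $S$ is graph-convex if $\operatorname{gph}S$ is convex. The coderivative is defined by $x^*\in D^*S(\bar{x}\mid\bar{u})(u^* )\iff(x^*,-u^* )\in N_{\operatorname{gph}S}(\bar{x},\bar{u})$. The projectional coderivative (for $\bar{x}\in X$, $\bar{u}\in S(\bar{x})$, $S:\mathbb{R}^n\rightrightarrows\mathbb{R}^m$) is defined by $$t^*\in D^*_XS(\bar{x}\mid\bar{u})(u^* )\iff(t^*,-u^* )\in\limsup_{(x,u)\to(\bar{x},\bar{u}),\,(x,u)\in\operatorname{gph}S|_X}\operatorname{proj}_{T_X(x)\times\mathbb{R}^m}N_{\operatorname{gph}S|_X}(x,u),$$ with $\limsup$ the (Painlevé–Kuratowski) outer limit of sets. $S$ is outer semicontinuous at $\bar{x}$ relative to $X$ if $\bar{x}\in X$ and $\limsup_{x\to\bar{x},\,x\in X}S(x)=S(\bar{x})$; it is outer semicontinuous relative to $X$ if this holds at every point of $X$, and outer semicontinuous if $X$ is the whole space. $S$ is locally bounded relative to $X$ at $\bar{x}\in X$ if $S(V\cap X)$ is bounded for some neighborhood $V$ of $\bar{x}$ (locally bounded at $\bar{x}$ when $X$ is the whole space). $S$ has the Lipschitz-like property at $\bar{x}$ for $\bar{u}\in S(\bar{x})$ if $\operatorname{gph}S$ is locally closed at $(\bar{x},\bar{u})$ and there are neighborhoods $V$ of $\bar{x}$, $W$ of $\bar{u}$ and $\kappa\ge0$ with $S(x')\cap W\subset S(x)+\kappa\|x'-x\|\mathbb{B}$ for all $x,x'\in V$, where $\mathbb{B}$ is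 the closed unit ball. $X$ is a ($d$-dimensional) smooth manifold around $\bar{x}\in X$ if there are an open neighborhood $O$ of $\bar{x}$ and a $\mathcal{C}^1$ mapping $F:O\to\mathbb{R}^{n-d}$ with $\nabla F(\bar{x})$ of full rank $n-d$ such that $X\cap O=\{x\in O\mid F(x)=0\}$.
   Formalization: The remark that S₂∘S₁|_X is outer semicontinuous is false from (a) at one point; it is proved when (a) holds at every (x,u), and from (a) at (x̄,ū) only locally: x ↦ (S₂∘S₁|_X)(x)∩W is osc relative to V for some closed neighborhoods V of x̄, W of ū. *)

theory Defs
  imports "HOL-Analysis.Analysis"
begin

section \<open>Set-valued mappings\<close>

definition gph :: "('a \<Rightarrow> 'b set) \<Rightarrow> ('a \<times> 'b) set" where
  "gph S = {(x, u). u \<in> S x}"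

definition sv_restrict :: "('a \<Rightarrow> 'b set) \<Rightarrow> 'a set \<Rightarrow> 'a \<Rightarrow> 'b set" where
  "sv_restrict S X x = (if x \<in> X then S x else {})"

definition sv_inverse :: "('a \<Rightarrow> 'b set) \<Rightarrow> 'b \<Rightarrow> 'a set" where
  "sv_inverse S u = {x. u \<in> S x}"

definition sv_comp :: "('b \<Rightarrow> 'c set) \<Rightarrow> ('a \<Rightarrow> 'b set) \<Rightarrow> 'a \<Rightarrow> 'c set" where
  "sv_comp A B y = (\<Union>z\<in>B y. A z)"

definition graph_convex :: "('a::real_vector \<Rightarrow> 'b::real_vector set) \<Rightarrow> bool" where
  "graph_convex S \<longleftrightarrow> convex (gph S)"

text \<open>Painleve--Kuratowski outer limit of \<open>S x'\<close> as \<open>x'\<close> tends to \<open>x\<close> within \<open>D\<close>. The value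
  \<open>x' = x\<close> is not excluded when \<open>x \<in> D\<close>.\<close>

definition outer_limit :: "('a::topological_space \<Rightarrow> 'b::topological_space set) \<Rightarrow> 'a set \<Rightarrow> 'a \<Rightarrow> 'b set" where
  "outer_limit S D x =
     {u. \<exists>xs us. (\<forall>k::nat. xs k \<in> D) \<and> xs \<longlonglongrightarrow> x \<and> (\<forall>k. us k \<in> S (xs k)) \<and> us \<longlonglongrightarrow> u}"

definition osc_at_rel ::
  "('a::topological_space \<Rightarrow> 'b::topological_space set) \<Rightarrow> 'a set \<Rightarrow> 'a \<Rightarrow> bool" where
  "osc_at_rel S X x \<longleftrightarrow> x \<in> X \<and> outer_limit S X x = S x"

definition osc_rel :: "('a::topological_space \<Rightarrow> 'b::topological_space set) \<Rightarrow> 'a set \<Rightarrow> bool" where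
  "osc_rel S X \<longleftrightarrow> (\<forall>x\<in>X. osc_at_rel S X x)"

definition osc :: "('a::topological_space \<Rightarrow> 'b::topological_space set) \<Rightarrow> bool" where
  "osc S \<longleftrightarrow> osc_rel S UNIV"

definition locally_bounded_rel ::
  "('a::topological_space \<Rightarrow> 'b::metric_space set) \<Rightarrow> 'a set \<Rightarrow> 'a \<Rightarrow> bool" where
  "locally_bounded_rel S X x \<longleftrightarrow> x \<in> X \<and> (\<exists>V. x \<in> interior V \<and> bounded (\<Union>y\<in>V \<inter> X. S y))"

definition locally_bounded :: "('a::topological_space \<Rightarrow> 'b::metric_space set) \<Rightarrow> 'a \<Rightarrow> bool" where
  "locally_bounded S x \<longleftrightarrow> locally_bounded_rel S UNIV x"

definition locally_closed_at :: "'a::topological_space set \<Rightarrow> 'a \<Rightarrow> bool" where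
  "locally_closed_at C x \<longleftrightarrow> x \<in> C \<and> (\<exists>U. closed U \<and> x \<in> interior U \<and> closed (C \<inter> U))"

definition lipschitz_like ::
  "('a::real_normed_vector \<Rightarrow> 'b::real_normed_vector set) \<Rightarrow> 'a \<Rightarrow> 'b \<Rightarrow> bool" where
  "lipschitz_like S xb ub \<longleftrightarrow>
     locally_closed_at (gph S) (xb, ub) \<and>
     (\<exists>V W \<kappa>. xb \<in> interior V \<and> ub \<in> interior W \<and> \<kappa> \<ge> 0 \<and>
        (\<forall>x\<in>V. \<forall>x'\<in>V.
           S x' \<inter> W \<subseteq> {u + (\<kappa> * norm (x' - x)) *\<^sub>R b | u b. u \<in> S x \<and> b \<in> cball 0 1}))"

section \<open>Tangent cones, normal cones, projections\<close>

definition tangent_cone :: "'a::real_normed_vector set \<Rightarrow> 'a \<Rightarrow> 'a set" where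
  "tangent_cone C x =
     (if x \<in> C then outer_limit (\<lambda>t::real. (\<lambda>y. (y - x) /\<^sub>R t) ` C) {0<..} 0 else {})"

text \<open>If \<open>x\<close> is isolated in \<open>C\<close>, the filter is \<open>bot\<close> and the upper limit is \<open>-\<infinity>\<close>, so every
  vector is regular normal, in accordance with the usual convention.\<close>

definition regular_normal_cone :: "'a::real_inner set \<Rightarrow> 'a \<Rightarrow> 'a set" where
  "regular_normal_cone C x =
     (if x \<in> C
      then {v. Limsup (at x within C) (\<lambda>x'. ereal (v \<bullet> (x' - x) / norm (x' - x))) \<le> 0}
      else {})"

definition normal_cone :: "'a::real_inner set \<Rightarrow> 'a \<Rightarrow> 'a set" where
  "normal_cone C x =
     (if x \<in> C
      then {v. \<exists>xs vs. (\<forall>k::nat. xs k \<in> C) \<and> xs \<longlonglongrightarrow> x \<and>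
                 (\<forall>k. vs k \<in> regular_normal_cone C (xs k)) \<and> vs \<longlonglongrightarrow> v}
      else {})"

definition proj :: "'a::real_normed_vector set \<Rightarrow> 'a \<Rightarrow> 'a set" where
  "proj C x = {y \<in> C. norm (y - x) = infdist x C}"

definition proj_set :: "'a::real_normed_vector set \<Rightarrow> 'a set \<Rightarrow> 'a set" where
  "proj_set C A = (\<Union>a\<in>A. proj C a)"

section \<open>Coderivatives\<close>

text \<open>The norm and inner product on a product type are the Euclidean ones.\<close>

definition coderiv ::
  "('a::real_inner \<Rightarrow> 'b::real_inner set) \<Rightarrow> 'a \<Rightarrow> 'b \<Rightarrow> 'b \<Rightarrow> 'a set" where
  "coderiv S xb ub us = {xs. (xs, - us) \<in> normal_cone (gph S) (xb, ub)}"

text \<open>Projectional coderivative of \<open>S\<close> relative to \<open>X\<close>, meant for \<open>xb \<in> X\<close> and \<open>ub \<in> S xb\<close>.\<close>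

definition proj_coderiv ::
  "'a set \<Rightarrow> ('a::real_inner \<Rightarrow> 'b::real_inner set) \<Rightarrow> 'a \<Rightarrow> 'b \<Rightarrow> 'b \<Rightarrow> 'a set" where
  "proj_coderiv X S xb ub us =
     {ts. (ts, - us) \<in>
        outer_limit
          (\<lambda>(x, u). proj_set (tangent_cone X x \<times> UNIV) (normal_cone (gph (sv_restrict S X)) (x, u)))
          (gph (sv_restrict S X)) (xb, ub)}"

section \<open>Smooth manifolds\<close>

text \<open>The \<open>\<C>\<^sup>1\<close> mapping into the space of dimension \<open>DIM('a) - d\<close> is given by its components
  \<open>F i\<close> for \<open>i < DIM('a) - d\<close>, with gradients \<open>G i\<close>; this allows the codimension to be \<open>0\<close>. The
  gradients at \<open>xb\<close> are the rows of the Jacobian, so the \<open>dim\<close> condition says that its rank is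
  \<open>DIM('a) - d\<close>.\<close>

definition smooth_manifold_around :: "nat \<Rightarrow> 'a::euclidean_space set \<Rightarrow> 'a \<Rightarrow> bool" where
  "smooth_manifold_around d X xb \<longleftrightarrow>
     xb \<in> X \<and> d \<le> DIM('a) \<and>
     (\<exists>(U::'a set) (F::nat \<Rightarrow> 'a \<Rightarrow> real) (G::nat \<Rightarrow> 'a \<Rightarrow> 'a).
        open U \<and> xb \<in> U \<and>
        (\<forall>i<DIM('a) - d. (\<forall>x\<in>U. GDERIV (F i) x :> G i x) \<and> continuous_on U (G i)) \<and>
        dim ((\<lambda>i. G i xb) ` {..<DIM('a) - d}) = DIM('a) - d \<and>
        X \<inter> U = {x \<in> U. \<forall>i<DIM('a) - d. F i x = 0})"

end

theory Submission
  imports Defs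
begin

text \<open>Put \<open>C1 = gph (sv_restrict S1 X)\<close> and \<open>C2 = gph S2\<close>. The graph of the composition is the relational
composition \<open>C1 O C2\<close>, and everything is a statement about normals to such a set.

The core is a multiplier rule in Fritz John form (\<open>normal_cone_relcomp_multiplier\<close>): where the
intermediate points stay bounded, a limiting normal \<open>(a, b)\<close> to \<open>C1 O C2\<close> at \<open>(x, u)\<close> comes with an
intermediate point \<open>w\<close>, a number \<open>l \<ge> 0\<close> and a vector \<open>q\<close> such that \<open>l + norm q = 1\<close>,
\<open>(l a, - q)\<close> is normal to \<open>C1\<close> at \<open>(x, w)\<close> and \<open>(q, l b)\<close> is normal to \<open>C2\<close> at \<open>(w, u)\<close>. It is
obtained by penalisation. Regular normals to a locally closed set are limits of proximal normals; a proximal normal says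
that the base point locally minimises a linear functional plus a quadratic one over \<open>C1 O C2\<close>. One doubles
the intermediate variable, minimises over \<open>C1 \<times> C2\<close> with the penalty \<open>j * (norm (w - w'))\<^sup>2\<close>, and
reads off normals to \<open>C1\<close> and \<open>C2\<close> at the minimisers; the multiplier is the gradient of the penalty.

The normalisation keeps the pairs \<open>(l, q)\<close> in a compact set, so the same compactness argument
(\<open>multiplier_compactness\<close>) gives the rule for limiting normals and then, once more, for limits of
projected normals. The projection onto \<open>tangent_cone X x \<times> UNIV\<close> leaves the second component alone
and commutes with scaling, so it respects the multiplier rule at each fixed point; but it is not
continuous in \<open>x\<close>, which is why the rule is needed for limiting normals at all points near the
reference point before the last limit is taken. The qualification condition at the reference
point says precisely that \<open>l = 0\<close> is impossible there, and dividing by \<open>l\<close> gives the inclusion. A Lipschitz-like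
\<open>S2\<close> satisfies the condition because the Lipschitz constant bounds the first component of a normal to
its graph by the second.

In the convex case limiting normals are the vectors that make a nonpositive product with all
feasible displacements. Displacements in a convex set over \<open>X\<close> project to tangent vectors of \<open>X\<close>,
and the tangent spaces of a smooth manifold vary continuously; so the projectional
coderivative consists exactly of the normals whose first component is tangent to \<open>X\<close>
(\<open>outer_limit_projected_normal_cone_convex\<close>). Adding the two normal inequalities gives the reverse
inclusion, and comparing them at two intermediate points shows that one multiplier serves all
intermediate points.\<close>

section \<open>Outer limits\<close>

lemma outer_limitI:
  assumes "\<And>k. xs k \<in> D" "xs \<longlonglongrightarrow> x" "\<And>k. us k \<in> S (xs k)" "us \<longlonglongrightarrow> u"
  shows "u \<in> outer_limit S D x"
  using assms unfolding outer_limit_def by blast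

lemma outer_limitE:
  assumes "u \<in> outer_limit S D x"
  obtains xs us where "\<And>k::nat. xs k \<in> D" "xs \<longlonglongrightarrow> x" "\<And>k. us k \<in> S (xs k)" "us \<longlonglongrightarrow> u"
  using assms unfolding outer_limit_def by blast

lemma outer_limit_self:
  assumes "x \<in> D" "u \<in> S x"
  shows "u \<in> outer_limit S D x"
  by (rule outer_limitI[where xs = "\<lambda>_. x" and us = "\<lambda>_. u"]) (use assms in auto)

lemma dist_le_inverse_Suc_imp_LIMSEQ:
  fixes ys :: "nat \<Rightarrow> 'a::metric_space"
  assumes xs: "xs \<longlonglongrightarrow> x" and d: "\<And>k. dist (ys k) (xs k) \<le> inverse (real (Suc k))"
  shows "ys \<longlonglongrightarrow> x"
proof -
  have "(\<lambda>k. inverse (real (Suc k)) + dist (xs k) x) \<longlonglongrightarrow> 0 + 0"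
    by (rule tendsto_add[OF LIMSEQ_inverse_real_of_nat xs[unfolded tendsto_dist_iff[of xs]]])
  moreover have "dist (ys k) x \<le> inverse (real (Suc k)) + dist (xs k) x" for k
    using d[of k] dist_triangle[of "ys k" x "xs k"] by linarith
  ultimately have "(\<lambda>k. dist (ys k) x) \<longlonglongrightarrow> 0"
    by - (rule Lim_null_comparison[where g = "\<lambda>k. inverse (real (Suc k)) + dist (xs k) x"],
      simp_all del: of_nat_Suc)
  then show ?thesis by (rule tendsto_dist_iff[THEN iffD2])
qed

text \<open>Diagonal argument: each point of the iterated limit is replaced by a nearby point of a sequence that
defines it.\<close>

lemma outer_limit_idem:
  fixes S :: "'a::metric_space \<Rightarrow> 'b::metric_space set"
  assumes "u \<in> outer_limit (\<lambda>x. outer_limit S D x) D x"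
  shows "u \<in> outer_limit S D x"
proof -
  obtain xs us where xs: "\<And>k::nat. xs k \<in> D" "xs \<longlonglongrightarrow> x"
      and us: "\<And>k. us k \<in> outer_limit S D (xs k)" "us \<longlonglongrightarrow> u"
    using assms by (rule outer_limitE) blast
  \<comment> \<open>Replace the \<open>k\<close>-th limit by a member of its defining sequence, up to an error that tends to \<open>0\<close>.\<close>
  have "\<exists>y v. y \<in> D \<and> v \<in> S y \<and> dist y (xs k) \<le> inverse (real (Suc k))
          \<and> dist v (us k) \<le> inverse (real (Suc k))" for k
  proof -
    obtain ys vs where ys: "\<And>i::nat. ys i \<in> D" "ys \<longlonglongrightarrow> xs k"
        and vs: "\<And>i. vs i \<in> S (ys i)" "vs \<longlonglongrightarrow> us k"
      using us(1)[of k] by (rule outer_limitE) blast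
    have e: "inverse (real (Suc k)) > 0" by simp
    have "eventually (\<lambda>i. dist (ys i) (xs k) < inverse (real (Suc k))
            \<and> dist (vs i) (us k) < inverse (real (Suc k))) sequentially"
      using tendstoD[OF ys(2) e] tendstoD[OF vs(2) e] by eventually_elim auto
    then obtain i where "dist (ys i) (xs k) < inverse (real (Suc k))"
        "dist (vs i) (us k) < inverse (real (Suc k))"
      using eventually_happens by force
    then show ?thesis using ys(1)[of i] vs(1)[of i] by (intro exI[of _ "ys i"] exI[of _ "vs i"]) auto
  qed
  then obtain ys vs where *: "\<And>k. ys k \<in> D" "\<And>k. vs k \<in> S (ys k)"
      "\<And>k. dist (ys k) (xs k) \<le> inverse (real (Suc k))"
      "\<And>k. dist (vs k) (us k) \<le> inverse (real (Suc k))"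
    by metis
  show ?thesis
  proof (rule outer_limitI)
    show "ys \<longlonglongrightarrow> x" "vs \<longlonglongrightarrow> u"
      by (rule dist_le_inverse_Suc_imp_LIMSEQ[OF xs(2) *(3)]
          dist_le_inverse_Suc_imp_LIMSEQ[OF us(2) *(4)])+
  qed (use * in auto)
qed

section \<open>Regular, limiting and proximal normals\<close>

lemma normal_cone_eq_outer_limit:
  assumes "x \<in> C"
  shows "normal_cone C x = outer_limit (regular_normal_cone C) C x"
  using assms unfolding normal_cone_def outer_limit_def by simp

text \<open>The quantitative form of the defining upper limit; the case \<open>y = x\<close> may be included because both sides
of the inequality vanish there.\<close>

lemma regular_normal_cone_iff:
  "v \<in> regular_normal_cone C x \<longleftrightarrow>
     x \<in> C \<and> (\<forall>e>0. \<exists>d>0. \<forall>y\<in>C. dist y x < d \<longrightarrow> v \<bullet> (y - x) \<le> e * norm (y - x))"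
  (is "_ \<longleftrightarrow> _ \<and> ?R")
proof (cases "x \<in> C")
  case True
  let ?f = "\<lambda>y. ereal (v \<bullet> (y - x) / norm (y - x))"
  have "Limsup (at x within C) ?f \<le> 0 \<longleftrightarrow> (\<forall>y>0. \<forall>\<^sub>F z in at x within C. ?f z < y)"
    by (rule Limsup_le_iff)
  also have "\<dots> \<longleftrightarrow> ?R"
  proof
    assume L: "\<forall>y>0. \<forall>\<^sub>F z in at x within C. ?f z < y"
    show ?R
    proof (intro allI impI)
      fix e :: real assume "e > 0"
      then have "\<forall>\<^sub>F z in at x within C. ?f z < ereal e" using L[rule_format, of "ereal e"] by simp
      then obtain d where d: "d > 0" "\<And>y. \<lbrakk>y \<in> C; y \<noteq> x; dist y x < d\<rbrakk> \<Longrightarrow> v \<bullet> (y - x) / norm (y - x) < e"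
        unfolding eventually_at by auto
      have "v \<bullet> (y - x) \<le> e * norm (y - x)" if "y \<in> C" "dist y x < d" for y
      proof (cases "y = x")
        case False
        then show ?thesis using d(2)[OF that(1) False that(2)] by (simp add: field_simps)
      qed simp
      then show "\<exists>d>0. \<forall>y\<in>C. dist y x < d \<longrightarrow> v \<bullet> (y - x) \<le> e * norm (y - x)"
        using d(1) by blast
    qed
  next
    assume R: ?R
    show "\<forall>y>0. \<forall>\<^sub>F z in at x within C. ?f z < y"
    proof (intro allI impI)
      fix c :: ereal assume "c > 0"
      then obtain e where e: "0 < ereal e" "ereal e < c" using ereal_dense2 by blast
      then obtain d where d: "d > 0" "\<forall>y\<in>C. dist y x < d \<longrightarrow> v \<bullet> (y - x) \<le> e * norm (y - x)"
        using R by auto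
      have "?f y < c" if "y \<in> C" "y \<noteq> x" "dist y x < d" for y
      proof -
        have "v \<bullet> (y - x) / norm (y - x) \<le> e" using d(2) that by (simp add: field_simps)
        then show ?thesis using e(2) le_less_trans by (metis ereal_less_eq(3))
      qed
      then show "\<forall>\<^sub>F z in at x within C. ?f z < c" unfolding eventually_at using d(1) by auto
    qed
  qed
  finally show ?thesis using True by (simp add: regular_normal_cone_def)
qed (simp add: regular_normal_cone_def)

lemma normal_cone_outer_limit_subset:
  assumes "x \<in> C" "v \<in> outer_limit (normal_cone C) C x"
  shows "v \<in> normal_cone C x"
proof -
  obtain xs vs where *: "\<And>k::nat. xs k \<in> C" "xs \<longlonglongrightarrow> x" "\<And>k. vs k \<in> normal_cone C (xs k)" "vs \<longlonglongrightarrow> v"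
    using assms(2) by (rule outer_limitE) blast
  have "v \<in> outer_limit (\<lambda>x. outer_limit (regular_normal_cone C) C x) C x"
    by (rule outer_limitI[where xs = xs and us = vs])
      (use * normal_cone_eq_outer_limit[OF *(1)] in auto)
  then show ?thesis
    using outer_limit_idem normal_cone_eq_outer_limit[OF assms(1)] by blast
qed

lemma regular_normal_cone_scale:
  assumes v: "v \<in> regular_normal_cone C x" and l: "l \<ge> 0"
  shows "l *\<^sub>R v \<in> regular_normal_cone C x"
proof (cases "l = 0")
  case True
  then show ?thesis
    using v unfolding regular_normal_cone_iff by (auto intro!: exI[of _ 1])
next
  case False
  then have l: "l > 0" using l by simp
  show ?thesis unfolding regular_normal_cone_iff
  proof (intro conjI allI impI)
    show "x \<in> C" using v unfolding regular_normal_cone_iff by blast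
    fix e :: real assume "e > 0"
    then have "e / l > 0" using l by simp
    then obtain d where d: "d > 0" "\<forall>y\<in>C. dist y x < d \<longrightarrow> v \<bullet> (y - x) \<le> e / l * norm (y - x)"
      using v unfolding regular_normal_cone_iff by blast
    then have "\<forall>y\<in>C. dist y x < d \<longrightarrow> (l *\<^sub>R v) \<bullet> (y - x) \<le> e * norm (y - x)"
      using l by (auto simp: field_simps)
    then show "\<exists>d>0. \<forall>y\<in>C. dist y x < d \<longrightarrow> (l *\<^sub>R v) \<bullet> (y - x) \<le> e * norm (y - x)"
      using d(1) by blast
  qed
qed

lemma normal_cone_scale:
  assumes v: "v \<in> normal_cone C x" and l: "l \<ge> 0"
  shows "l *\<^sub>R v \<in> normal_cone C x"
proof -
  have x: "x \<in> C" using v by (auto simp: normal_cone_def split: if_splits)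
  then obtain xs vs where *: "\<And>k::nat. xs k \<in> C" "xs \<longlonglongrightarrow> x"
      "\<And>k. vs k \<in> regular_normal_cone C (xs k)" "vs \<longlonglongrightarrow> v"
    using v unfolding normal_cone_eq_outer_limit[OF x] by (elim outer_limitE) blast
  show ?thesis unfolding normal_cone_eq_outer_limit[OF x]
    by (rule outer_limitI[where xs = xs and us = "\<lambda>k. l *\<^sub>R vs k"])
      (use * l in \<open>auto intro!: tendsto_intros regular_normal_cone_scale\<close>)
qed

lemma zero_in_normal_cone: "x \<in> C \<Longrightarrow> 0 \<in> normal_cone C x"
  unfolding normal_cone_eq_outer_limit
  by (rule outer_limit_self) (auto simp: regular_normal_cone_iff intro!: exI[of _ 1])

text \<open>With a quadratic bound in place of the little-o bound of a regular normal, \<open>z\<close> is a strict local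
minimiser over \<open>C\<close> of an explicit smooth function: minus the functional \<open>v\<close> plus a quadratic.\<close>

definition proximal_normal :: "'a::real_inner set \<Rightarrow> 'a \<Rightarrow> 'a \<Rightarrow> bool" where
  "proximal_normal C z v \<longleftrightarrow>
     z \<in> C \<and> (\<exists>\<sigma> d. d > 0 \<and> (\<forall>y\<in>C. dist y z < d \<longrightarrow> v \<bullet> (y - z) \<le> \<sigma> * (norm (y - z))\<^sup>2))"

lemma proximal_normalE:
  assumes "proximal_normal C z v"
  obtains \<sigma> d where "\<sigma> \<ge> 0" "d > 0"
    "\<And>y. \<lbrakk>y \<in> C; dist y z < d\<rbrakk> \<Longrightarrow> v \<bullet> (y - z) \<le> \<sigma> * (norm (y - z))\<^sup>2"
proof -
  obtain \<sigma> d where *: "d > 0" "\<And>y. \<lbrakk>y \<in> C; dist y z < d\<rbrakk> \<Longrightarrow> v \<bullet> (y - z) \<le> \<sigma> * (norm (y - z))\<^sup>2"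
    using assms unfolding proximal_normal_def by blast
  have "v \<bullet> (y - z) \<le> max \<sigma> 0 * (norm (y - z))\<^sup>2" if "y \<in> C" "dist y z < d" for y
  proof -
    have "\<sigma> * (norm (y - z))\<^sup>2 \<le> max \<sigma> 0 * (norm (y - z))\<^sup>2"
      by (rule mult_right_mono) auto
    then show ?thesis using *(2)[OF that] by linarith
  qed
  then show thesis using that[of "max \<sigma> 0" d] *(1) by auto
qed

lemma proximal_normal_imp_regular:
  assumes "proximal_normal C z v"
  shows "v \<in> regular_normal_cone C z"
  unfolding regular_normal_cone_iff
proof (intro conjI allI impI)
  show "z \<in> C" using assms by (simp add: proximal_normal_def)
  fix e :: real assume e: "e > 0"
  obtain \<sigma> d where s: "\<sigma> \<ge> 0" "d > 0"
    "\<And>y. \<lbrakk>y \<in> C; dist y z < d\<rbrakk> \<Longrightarrow> v \<bullet> (y - z) \<le> \<sigma> * (norm (y - z))\<^sup>2"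
    using assms by (rule proximal_normalE) blast
  show "\<exists>d>0. \<forall>y\<in>C. dist y z < d \<longrightarrow> v \<bullet> (y - z) \<le> e * norm (y - z)"
  proof (intro exI conjI ballI impI)
    show "min d (e / (\<sigma> + 1)) > 0" using s e by simp
    fix y assume y: "y \<in> C" "dist y z < min d (e / (\<sigma> + 1))"
    have "norm (y - z) * (\<sigma> + 1) \<le> e"
      using y(2) s(1) by (simp add: dist_norm pos_less_divide_eq less_imp_le)
    then have "\<sigma> * norm (y - z) \<le> e" by (simp add: algebra_simps) (smt (verit) norm_ge_zero)
    then have "\<sigma> * norm (y - z) * norm (y - z) \<le> e * norm (y - z)"
      by (rule mult_right_mono) simp
    then show "v \<bullet> (y - z) \<le> e * norm (y - z)"
      using s(3)[OF y(1)] y(2) by (simp add: power2_eq_square mult.assoc)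
  qed
qed

text \<open>Project \<open>y = z + t v\<close> onto \<open>C\<close> for small \<open>t > 0\<close>. The projection \<open>z'\<close> carries the proximal normal
\<open>(y - z') / t\<close>, and the regular normal inequality for \<open>v\<close> makes \<open>norm (z' - z)\<close> of smaller order
than \<open>t\<close>; the distance between the two normals is \<open>norm (z' - z) / t\<close>.\<close>

lemma regular_normal_approx_proximal:
  fixes C :: "'a::euclidean_space set"
  assumes v: "v \<in> regular_normal_cone C z" and r: "r > 0" and cl: "closed (C \<inter> cball z r)"
    and e: "e > 0"
  shows "\<exists>z' v'. proximal_normal C z' v' \<and> dist z' z \<le> e \<and> dist v' v \<le> e"
proof -
  define D where "D = C \<inter> cball z r"
  have z: "z \<in> C" "z \<in> D" using v r unfolding regular_normal_cone_iff D_def by auto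
  obtain d where d: "d > 0" "\<And>y. y \<in> C \<Longrightarrow> dist y z < d \<Longrightarrow> v \<bullet> (y - z) \<le> (e / 2) * norm (y - z)"
    using v e unfolding regular_normal_cone_iff by (metis half_gt_zero)
  define m where "m = min (min d r) e"
  have m: "m > 0" using d r e by (auto simp: m_def)
  define t where "t = m / (4 * (norm v + 1))"
  have t: "t > 0" using m by (auto simp: t_def add_nonneg_pos)
  have "norm v + 1 > 0" by (simp add: add_nonneg_pos)
  then have "t * (norm v + 1) = m / 4" by (simp add: t_def field_simps)
  then have tv: "2 * (t * norm v) < m"
    using m t by (simp add: algebra_simps)
  define y where "y = z + t *\<^sub>R v"
  obtain z' where z': "z' \<in> D" "\<And>c. c \<in> D \<Longrightarrow> dist y z' \<le> dist y c"
    using distance_attains_inf[of D y] cl z(2) unfolding D_def by blast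
  have yz: "dist y z = t * norm v" using t by (simp add: y_def dist_norm)
  have z'z: "dist z' z < m"
    using z'(2)[OF z(2)] yz tv dist_triangle[of z' z y] by (simp add: dist_commute)
  have sq: "(norm (y - c))\<^sup>2 = (norm (y - z'))\<^sup>2 - 2 * ((y - z') \<bullet> (c - z')) + (norm (c - z'))\<^sup>2" for c
    unfolding power2_norm_eq_inner by (simp add: inner_diff inner_commute algebra_simps)
  \<comment> \<open>Optimality of the projection, with the squares expanded.\<close>
  have key: "2 * ((y - z') \<bullet> (c - z')) \<le> (norm (c - z'))\<^sup>2" if "c \<in> D" for c
  proof -
    have "(norm (y - z'))\<^sup>2 \<le> (norm (y - c))\<^sup>2"
      using z'(2)[OF that] by (simp add: dist_norm power_mono)
    then show ?thesis using sq[of c] by linarith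
  qed
  define v' where "v' = (y - z') /\<^sub>R t"
  have vv: "v' - v = (z - z') /\<^sub>R t" using t by (simp add: v'_def y_def algebra_simps)
  have "norm (z' - z) * norm (z' - z) \<le> 2 * t * (e / 2) * norm (z' - z)"
  proof -
    have yz': "y - z' = t *\<^sub>R v - (z' - z)" by (simp add: y_def)
    have "2 * ((t *\<^sub>R v - (z' - z)) \<bullet> (z - z')) \<le> (norm (z - z'))\<^sup>2"
      using key[OF z(2)] unfolding yz' .
    then have "(norm (z' - z))\<^sup>2 \<le> 2 * t * (v \<bullet> (z' - z))"
      unfolding power2_norm_eq_inner by (simp add: inner_diff inner_commute algebra_simps)
    also have "\<dots> \<le> 2 * t * ((e / 2) * norm (z' - z))"
      using t d(2)[of z'] z'(1) z'z by (intro mult_left_mono) (auto simp: D_def m_def)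
    finally show ?thesis by (simp add: power2_eq_square)
  qed
  then have "norm (z' - z) \<le> t * e"
    by (cases "z' = z") (use t e in auto)
  then have "norm (z - z') / t \<le> e"
    using t by (simp add: norm_minus_commute pos_divide_le_eq mult.commute)
  then have "norm (v' - v) \<le> e"
    unfolding vv using t by (simp add: divide_inverse mult.commute)
  moreover have "proximal_normal C z' v'"
    unfolding proximal_normal_def
  proof (intro conjI exI ballI impI)
    show "z' \<in> C" using z' by (simp add: D_def)
    show "r - dist z' z > 0" using z'z by (simp add: m_def)
    fix c assume c: "c \<in> C" "dist c z' < r - dist z' z"
    then have "c \<in> D" using dist_triangle[of c z z'] by (auto simp: D_def dist_commute)
    have "v' \<bullet> (c - z') = ((y - z') \<bullet> (c - z')) / t"
      by (simp only: v'_def inner_scaleR_left divide_inverse mult.commute)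
    then show "v' \<bullet> (c - z') \<le> 1 / (2 * t) * (norm (c - z'))\<^sup>2"
      using key[OF \<open>c \<in> D\<close>] t by (simp add: field_simps)
  qed
  ultimately show ?thesis using z'z by (intro exI[of _ z'] exI[of _ v']) (auto simp: dist_norm m_def)
qed

lemma norm_diff_sq_expand:
  fixes x y c :: "'a::real_inner"
  shows "(norm (x - c))\<^sup>2 = (norm (y - c))\<^sup>2 + 2 * ((y - c) \<bullet> (x - y)) + (norm (x - y))\<^sup>2"
  unfolding power2_norm_eq_inner by (simp add: inner_diff inner_commute algebra_simps)

section \<open>Normals to a relational composition\<close>

text \<open>Penalisation. The point \<open>((x, w), (w', u))\<close> ranges over \<open>C1 \<times> C2\<close> near the base point, and \<open>w = w'\<close> is
only enforced by a penalty with weight \<open>j\<close>. The term \<open>(norm (w - w0))\<^sup>2\<close> and the excess of the quadratic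
coefficient \<open>\<sigma> + 1\<close> over \<open>\<sigma>\<close> make the base point the only solution of the limiting problem, so the minimisers
converge to it. At a minimiser both blocks of variables satisfy a proximal normal inequality, with
the gradient of the penalty as a common multiplier. Nothing bounds this multiplier; the factor \<open>l\<close>
rescales the pair of normals.\<close>

lemma proximal_normal_relcomp_fuzzy:
  fixes C1 :: "('a::euclidean_space \<times> 'b::euclidean_space) set"
    and C2 :: "('b \<times> 'c::euclidean_space) set"
  assumes cl: "closed C1" "closed C2" and in1: "(x0, w0) \<in> C1" and in2: "(w0, u0) \<in> C2"
    and prox: "proximal_normal (C1 O C2) (x0, u0) (a, b)" and e: "e > 0"
  shows "\<exists>x w w' u a' b' l q q'.
     dist x x0 \<le> e \<and> dist w w0 \<le> e \<and> dist w' w0 \<le> e \<and> dist u u0 \<le> e \<and>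
     dist a' a \<le> e \<and> dist b' b \<le> e \<and> dist q' q \<le> e \<and> l \<ge> 0 \<and> l + norm q = 1 \<and>
     (l *\<^sub>R a', - q) \<in> regular_normal_cone C1 (x, w) \<and>
     (q', l *\<^sub>R b') \<in> regular_normal_cone C2 (w', u)"
proof -
  obtain \<sigma> d where s: "\<sigma> \<ge> 0" "d > 0"
    and sd: "\<And>y. \<lbrakk>y \<in> C1 O C2; dist y (x0, u0) < d\<rbrakk> \<Longrightarrow>
        (a, b) \<bullet> (y - (x0, u0)) \<le> \<sigma> * (norm (y - (x0, u0)))\<^sup>2"
    using prox by (rule proximal_normalE) blast
  define r where "r = d / 2"
  have r: "r > 0" "r < d" using s by (auto simp: r_def)
  define p0 where "p0 = ((x0, w0), (w0, u0))"
  define K where "K = (C1 \<times> C2) \<inter> cball p0 r"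
  define \<psi> where "\<psi> = (\<lambda>((x::'a, w::'b), (w'::'b, u::'c)). - (a \<bullet> (x - x0)) - b \<bullet> (u - u0)
      + (\<sigma> + 1) * ((norm (x - x0))\<^sup>2 + (norm (u - u0))\<^sup>2) + (norm (w - w0))\<^sup>2)"
  define \<Delta> where "\<Delta> = (\<lambda>((x::'a, w::'b), (w'::'b, u::'c)). (norm (w - w'))\<^sup>2)"
  have K: "compact K" unfolding K_def by (intro closed_Int_compact closed_Times cl compact_cball)
  have p0: "p0 \<in> K" using in1 in2 r by (simp add: K_def p0_def)
  have cont: "continuous_on K \<psi>" "continuous_on K \<Delta>"
    unfolding \<psi>_def \<Delta>_def by (auto simp: case_prod_unfold intro!: continuous_intros)
  \<comment> \<open>Minimisers of the penalised problems; along a subsequence they converge to some \<open>p\<close>.\<close>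
  have "\<exists>p\<in>K. \<forall>q\<in>K. \<psi> p + real j * \<Delta> p \<le> \<psi> q + real j * \<Delta> q" for j
    by (rule continuous_attains_inf[OF K]) (use p0 cont in \<open>auto intro!: continuous_intros\<close>)
  then obtain P where P: "\<And>j. P j \<in> K" "\<And>j q. q \<in> K \<Longrightarrow> \<psi> (P j) + real j * \<Delta> (P j) \<le> \<psi> q + real j * \<Delta> q"
    by metis
  obtain f p where f: "p \<in> K" "strict_mono (f :: nat \<Rightarrow> nat)" "(P \<circ> f) \<longlonglongrightarrow> p"
    using K P(1) unfolding compact_def by metis
  have \<psi>0: "\<psi> (P j) + real j * \<Delta> (P j) \<le> 0" for j
    using P(2)[OF p0, of j] by (simp add: \<psi>_def \<Delta>_def p0_def)
  have \<Delta>0: "\<Delta> q \<ge> 0" for q by (simp add: \<Delta>_def case_prod_unfold)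
  have lim: "(\<lambda>j. \<psi> (P (f j))) \<longlonglongrightarrow> \<psi> p" "(\<lambda>j. \<Delta> (P (f j))) \<longlonglongrightarrow> \<Delta> p"
    using continuous_on_tendsto_compose[OF cont(1) f(3,1)]
      continuous_on_tendsto_compose[OF cont(2) f(3,1)] P(1) by (auto simp: o_def)
  have \<psi>p: "\<psi> p \<le> 0"
  proof (rule LIMSEQ_le_const2[OF lim(1)])
    have "\<psi> (P (f j)) \<le> 0" for j
      using mult_nonneg_nonneg[OF of_nat_0_le_iff \<Delta>0, of "f j" "P (f j)"] \<psi>0[of "f j"] by linarith
    then show "\<exists>N. \<forall>j\<ge>N. \<psi> (P (f j)) \<le> 0" by blast
  qed
  \<comment> \<open>The penalty \<open>j * \<Delta>\<close> at the minimisers is bounded by minus the minimum of \<open>\<psi>\<close>, hence \<open>\<Delta>\<close> vanishes in the limit.\<close>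
  have "\<Delta> p = 0"
  proof -
    obtain m where m: "\<And>q. q \<in> K \<Longrightarrow> \<psi> m \<le> \<psi> q"
      using continuous_attains_inf[OF K _ cont(1)] p0 by blast
    have "\<Delta> (P (f j)) \<le> (- \<psi> m) * (1 / real j)" if "j \<ge> 1" for j
    proof -
      have "real j * \<Delta> (P (f j)) \<le> real (f j) * \<Delta> (P (f j))"
        using seq_suble[OF f(2), of j] \<Delta>0 by (intro mult_right_mono) auto
      also have "\<dots> \<le> - \<psi> m" using \<psi>0[of "f j"] m[OF P(1), of "f j"] by linarith
      finally show ?thesis using that by (simp add: field_simps)
    qed
    moreover have "(\<lambda>j. (- \<psi> m) * (1 / real j)) \<longlonglongrightarrow> (- \<psi> m) * 0"
      by (intro tendsto_intros lim_1_over_n)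
    ultimately have "\<Delta> p \<le> (- \<psi> m) * 0"
      by (intro LIMSEQ_le[OF lim(2)]) auto
    then show ?thesis using \<Delta>0[of p] by simp
  qed
  then obtain x w u where p: "p = ((x, w), (w, u))"
    by (cases p) (auto simp: \<Delta>_def)
  \<comment> \<open>The limit is feasible for the undoubled problem, where the proximal inequality forces it to be the
    base point.\<close>
  have "p = p0"
  proof -
    have C: "(x, u) \<in> C1 O C2" using f(1) by (auto simp: K_def p)
    have "(norm ((x, u) - (x0, u0)))\<^sup>2 \<le> (norm (p - p0))\<^sup>2"
      by (simp add: p p0_def norm_prod_def)
    then have "norm ((x, u) - (x0, u0)) \<le> norm (p - p0)" by (rule power2_le_imp_le) simp
    also have "\<dots> < d" using f(1) r by (simp add: K_def dist_norm norm_minus_commute)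
    finally have "(a, b) \<bullet> ((x, u) - (x0, u0)) \<le> \<sigma> * (norm ((x, u) - (x0, u0)))\<^sup>2"
      by (intro sd C) (simp add: dist_norm)
    then have "a \<bullet> (x - x0) + b \<bullet> (u - u0) \<le> \<sigma> * ((norm (x - x0))\<^sup>2 + (norm (u - u0))\<^sup>2)"
      by (simp add: inner_prod_def norm_prod_def)
    then have "(norm (x - x0))\<^sup>2 + (norm (u - u0))\<^sup>2 + (norm (w - w0))\<^sup>2 \<le> 0"
      using \<psi>p by (simp add: \<psi>_def p algebra_simps)
    then have "(norm (x - x0))\<^sup>2 = 0 \<and> (norm (u - u0))\<^sup>2 = 0 \<and> (norm (w - w0))\<^sup>2 = 0"
      by (smt (verit) zero_le_power2)
    then show ?thesis by (simp add: p p0_def)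
  qed
  \<comment> \<open>Chosen so that the gradients of the quadratic terms are at most \<open>e\<close> at points within \<open>\<eta>\<close>.\<close>
  define \<eta> where "\<eta> = min r (e / (2 * (\<sigma> + 1)))"
  have "\<eta> > 0" using r e s by (simp add: \<eta>_def)
  then have "\<forall>\<^sub>F j in sequentially. dist ((P \<circ> f) j) p0 < \<eta>"
    using tendstoD[OF f(3)] \<open>p = p0\<close> by simp
  then obtain j' where j': "dist (P (f j')) p0 < \<eta>"
    using eventually_happens by force
  define j where "j = f j'"
  obtain x1 w1 w2 u1 where Pj: "P j = ((x1, w1), (w2, u1))" by (metis surj_pair)
  have "dist (x1, w1) (x0, w0) < \<eta>" "dist (w2, u1) (w0, u0) < \<eta>"
    using j' dist_fst_le[of "P j" p0] dist_snd_le[of "P j" p0] by (auto simp: j_def[symmetric] Pj p0_def)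
  then have near: "dist x1 x0 < \<eta>" "dist w1 w0 < \<eta>" "dist w2 w0 < \<eta>" "dist u1 u0 < \<eta>"
    using dist_fst_le[of "(x1, w1)" "(x0, w0)"] dist_snd_le[of "(x1, w1)" "(x0, w0)"]
      dist_fst_le[of "(w2, u1)" "(w0, u0)"] dist_snd_le[of "(w2, u1)" "(w0, u0)"] by auto
  have inC: "(x1, w1) \<in> C1" "(w2, u1) \<in> C2" using P(1)[of j] by (auto simp: Pj K_def)
  define \<rho> where "\<rho> = r - dist (P j) p0"
  have \<rho>: "\<rho> > 0" using j' by (simp add: \<rho>_def \<eta>_def j_def)
  have inK: "q \<in> K" if "q \<in> C1 \<times> C2" "dist q (P j) < \<rho>" for q
    using that dist_triangle[of q p0 "P j"] by (simp add: K_def \<rho>_def dist_commute)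
  \<comment> \<open>Negative partial gradients of the penalised objective at the minimiser. Those in \<open>w\<close> and \<open>w'\<close> are
    \<open>- q\<close> and \<open>q'\<close>; they differ by the gradient of the localising term only.\<close>
  define a' where "a' = a - (2 * (\<sigma> + 1)) *\<^sub>R (x1 - x0)"
  define b' where "b' = b - (2 * (\<sigma> + 1)) *\<^sub>R (u1 - u0)"
  define q' where "q' = (2 * real j) *\<^sub>R (w1 - w2)"
  define q where "q = q' + 2 *\<^sub>R (w1 - w0)"
  have pn1: "proximal_normal C1 (x1, w1) (a', - q)"
    unfolding proximal_normal_def
  proof (intro conjI exI ballI impI)
    fix y assume y: "y \<in> C1" "dist y (x1, w1) < \<rho>"
    obtain x w where [simp]: "y = (x, w)" by (cases y)
    have "((x, w), (w2, u1)) \<in> K"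
      using y inC by (intro inK) (auto simp: Pj dist_prod_def)
    from P(2)[OF this, of j]
    have "a' \<bullet> (x - x1) + (- q) \<bullet> (w - w1)
        \<le> (\<sigma> + 1) * (norm (x - x1))\<^sup>2 + (1 + real j) * (norm (w - w1))\<^sup>2"
      unfolding a'_def q_def q'_def Pj \<psi>_def \<Delta>_def
      by (simp add: norm_diff_sq_expand[of x x0 x1] norm_diff_sq_expand[of w w0 w1]
        norm_diff_sq_expand[of w w2 w1] algebra_simps inner_diff inner_add)
    also have "\<dots> \<le> (\<sigma> + 1 + real j) * (norm (x - x1))\<^sup>2 + (\<sigma> + 1 + real j) * (norm (w - w1))\<^sup>2"
      using s by (intro add_mono[OF mult_right_mono mult_right_mono]) auto
    finally show "(a', - q) \<bullet> (y - (x1, w1)) \<le> (\<sigma> + 1 + real j) * (norm (y - (x1, w1)))\<^sup>2"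
      by (simp add: norm_prod_def algebra_simps)
  qed (use inC \<rho> in auto)
  have pn2: "proximal_normal C2 (w2, u1) (q', b')"
    unfolding proximal_normal_def
  proof (intro conjI exI ballI impI)
    fix y assume y: "y \<in> C2" "dist y (w2, u1) < \<rho>"
    obtain w u where [simp]: "y = (w, u)" by (cases y)
    have "((x1, w1), (w, u)) \<in> K"
      using y inC by (intro inK) (auto simp: Pj dist_prod_def)
    from P(2)[OF this, of j]
    have "q' \<bullet> (w - w2) + b' \<bullet> (u - u1)
        \<le> real j * (norm (w - w2))\<^sup>2 + (\<sigma> + 1) * (norm (u - u1))\<^sup>2"
      unfolding b'_def q'_def Pj \<psi>_def \<Delta>_def
      by (simp add: norm_diff_sq_expand[of u u0 u1] norm_minus_commute[of w1 w] norm_minus_commute[of w1 w2]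
        norm_diff_sq_expand[of w w1 w2] algebra_simps inner_diff inner_add)
    also have "\<dots> \<le> (\<sigma> + 1 + real j) * (norm (w - w2))\<^sup>2 + (\<sigma> + 1 + real j) * (norm (u - u1))\<^sup>2"
      using s by (intro add_mono[OF mult_right_mono mult_right_mono]) auto
    finally show "(q', b') \<bullet> (y - (w2, u1)) \<le> (\<sigma> + 1 + real j) * (norm (y - (w2, u1)))\<^sup>2"
      by (simp add: norm_prod_def algebra_simps)
  qed (use inC \<rho> in auto)
  define l where "l = 1 / (1 + norm q)"
  have l: "l > 0" "l \<le> 1" "l + norm (l *\<^sub>R q) = 1"
  proof -
    have n: "1 + norm q > 0" by (simp add: add_pos_nonneg)
    then show "l > 0" "l \<le> 1" by (auto simp: l_def)
    then show "l + norm (l *\<^sub>R q) = 1" using n by (simp add: l_def field_simps)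
  qed
  have \<eta>e: "2 * (\<sigma> + 1) * \<eta> \<le> e" "\<eta> \<le> e" "2 * \<eta> \<le> e"
  proof -
    have "\<eta> \<le> e / (2 * (\<sigma> + 1))" by (simp add: \<eta>_def)
    then show 1: "2 * (\<sigma> + 1) * \<eta> \<le> e" using s by (simp add: field_simps)
    have "2 * 1 * \<eta> \<le> 2 * (\<sigma> + 1) * \<eta>"
      using \<open>\<eta> > 0\<close> s by (intro mult_right_mono mult_left_mono) auto
    then show "2 * \<eta> \<le> e" using 1 by simp
    then show "\<eta> \<le> e" using \<open>\<eta> > 0\<close> by simp
  qed
  have "dist a' a \<le> e" "dist b' b \<le> e"
  proof -
    have *: "dist (v - (2 * (\<sigma> + 1)) *\<^sub>R (y - y0)) v \<le> e" if "dist y y0 < \<eta>"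
      for v y y0 :: "'z::real_normed_vector"
    proof -
      have "dist (v - (2 * (\<sigma> + 1)) *\<^sub>R (y - y0)) v = 2 * (\<sigma> + 1) * dist y y0"
        using s by (simp add: dist_norm)
      also have "\<dots> \<le> 2 * (\<sigma> + 1) * \<eta>"
        using that s by (intro mult_left_mono) auto
      finally show ?thesis using \<eta>e(1) by linarith
    qed
    show "dist a' a \<le> e" "dist b' b \<le> e"
      unfolding a'_def b'_def by (rule *[OF near(1)] *[OF near(4)])+
  qed
  moreover have "dist (l *\<^sub>R q') (l *\<^sub>R q) \<le> e"
  proof -
    have "dist (l *\<^sub>R q') (l *\<^sub>R q) = l * norm (q' - q)"
      using l by (simp add: dist_norm scaleR_diff_right[symmetric])
    also have "\<dots> \<le> 1 * norm (q' - q)" by (intro mult_right_mono) (use l in auto)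
    also have "\<dots> = 2 * dist w1 w0" by (simp add: q_def dist_norm)
    finally show ?thesis using near \<eta>e by linarith
  qed
  moreover have "(l *\<^sub>R a', - (l *\<^sub>R q)) \<in> regular_normal_cone C1 (x1, w1)"
    "(l *\<^sub>R q', l *\<^sub>R b') \<in> regular_normal_cone C2 (w2, u1)"
    using regular_normal_cone_scale[OF proximal_normal_imp_regular[OF pn1], of l]
      regular_normal_cone_scale[OF proximal_normal_imp_regular[OF pn2], of l] l(1) by simp_all
  moreover have "dist x1 x0 \<le> e" "dist w1 w0 \<le> e" "dist w2 w0 \<le> e" "dist u1 u0 \<le> e"
    using near \<eta>e by linarith+
  ultimately show ?thesis using l less_imp_le[OF l(1)] by blast
qed

lemma outer_limit_imp_mem_closed:
  assumes "u \<in> outer_limit S D x" "closed D"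
  shows "x \<in> D"
  using assms(1) by (rule outer_limitE) (metis assms(2) closed_sequentially)

text \<open>The normalisation \<open>l k + norm (qs k) = 1\<close> survives the limit, so the limiting multipliers cannot both
vanish. Two nearby intermediate points and two nearby vectors \<open>q\<close> are allowed, as they arise from
penalisation.\<close>

lemma multiplier_compactness:
  fixes K1 :: "'a::metric_space \<times> 'b::euclidean_space \<Rightarrow> ('d::real_normed_vector \<times> 'e::euclidean_space) set"
    and K2 :: "'b \<times> 'c::metric_space \<Rightarrow> ('e \<times> 'f::real_normed_vector) set"
  assumes D: "\<And>k. (xs k, ws k) \<in> D1" "\<And>k. (ws' k, us k) \<in> D2"
    and lim: "xs \<longlonglongrightarrow> x" "us \<longlonglongrightarrow> u" "as \<longlonglongrightarrow> a" "bs \<longlonglongrightarrow> b"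
      "(\<lambda>k. dist (ws' k) (ws k)) \<longlonglongrightarrow> 0" "(\<lambda>k. dist (qs' k) (qs k)) \<longlonglongrightarrow> 0"
    and bd: "bounded (range ws)"
    and l: "\<And>k. l k \<ge> 0" "\<And>k. l k + norm (qs k) = 1"
    and K1: "\<And>k. (l k *\<^sub>R as k, - qs k) \<in> K1 (xs k, ws k)"
    and K2: "\<And>k. (qs' k, l k *\<^sub>R bs k) \<in> K2 (ws' k, us k)"
  shows "\<exists>w m q. m \<ge> 0 \<and> m + norm q = 1 \<and>
     (m *\<^sub>R a, - q) \<in> outer_limit K1 D1 (x, w) \<and> (q, m *\<^sub>R b) \<in> outer_limit K2 D2 (w, u)"
proof -
  have "norm (l k) \<le> 1" "norm (qs k) \<le> 1" for k
    using l(1)[of k] l(2)[of k] norm_ge_zero[of "qs k"] unfolding real_norm_def by linarith+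
  then have "bounded (range l)" "bounded (range qs)" unfolding bounded_iff by auto
  then have "bounded (range ws \<times> (range l \<times> range qs))" using bd by (intro bounded_Times)
  moreover have "range (\<lambda>k. (ws k, l k, qs k)) \<subseteq> range ws \<times> (range l \<times> range qs)" by auto
  ultimately have "bounded (range (\<lambda>k. (ws k, l k, qs k)))" by (rule bounded_subset)
  then obtain p r where r: "strict_mono (r :: nat \<Rightarrow> nat)" "((\<lambda>k. (ws k, l k, qs k)) \<circ> r) \<longlonglongrightarrow> p"
    using bounded_imp_convergent_subsequence by blast
  obtain w m q where p: "p = (w, m, q)" by (metis surj_pair)
  have *: "(\<lambda>k. ws (r k)) \<longlonglongrightarrow> w" "(\<lambda>k. l (r k)) \<longlonglongrightarrow> m" "(\<lambda>k. qs (r k)) \<longlonglongrightarrow> q"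
    using tendsto_fst[OF r(2)] tendsto_fst[OF tendsto_snd[OF r(2)]] tendsto_snd[OF tendsto_snd[OF r(2)]]
    by (simp_all add: p o_def)
  have sub: "(\<lambda>k. xs (r k)) \<longlonglongrightarrow> x" "(\<lambda>k. us (r k)) \<longlonglongrightarrow> u" "(\<lambda>k. as (r k)) \<longlonglongrightarrow> a" "(\<lambda>k. bs (r k)) \<longlonglongrightarrow> b"
    "(\<lambda>k. dist (ws' (r k)) (ws (r k))) \<longlonglongrightarrow> 0" "(\<lambda>k. dist (qs' (r k)) (qs (r k))) \<longlonglongrightarrow> 0"
    using lim[THEN LIMSEQ_subseq_LIMSEQ, OF r(1)] by (simp_all add: o_def)
  have w': "(\<lambda>k. ws' (r k)) \<longlonglongrightarrow> w"
    using Lim_transform[OF *(1), of "\<lambda>k. ws' (r k)"] sub(5)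
    by (simp add: dist_norm tendsto_norm_zero_iff)
  have q': "(\<lambda>k. qs' (r k)) \<longlonglongrightarrow> q"
    using Lim_transform[OF *(3), of "\<lambda>k. qs' (r k)"] sub(6)
    by (simp add: dist_norm tendsto_norm_zero_iff)
  have m: "m \<ge> 0" using LIMSEQ_le_const[OF *(2)] l(1) by blast
  have "(\<lambda>k. l (r k) + norm (qs (r k))) \<longlonglongrightarrow> m + norm q" by (intro tendsto_intros *)
  then have mq: "m + norm q = 1" by (simp add: l(2) LIMSEQ_const_iff)
  have "(m *\<^sub>R a, - q) \<in> outer_limit K1 D1 (x, w)"
    by (rule outer_limitI[where xs = "\<lambda>k. (xs (r k), ws (r k))" and us = "\<lambda>k. (l (r k) *\<^sub>R as (r k), - qs (r k))"])
      (use D K1 in \<open>auto intro!: tendsto_intros * sub\<close>)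
  moreover have "(q, m *\<^sub>R b) \<in> outer_limit K2 D2 (w, u)"
    by (rule outer_limitI[where xs = "\<lambda>k. (ws' (r k), us (r k))" and us = "\<lambda>k. (qs' (r k), l (r k) *\<^sub>R bs (r k))"])
      (use D K2 in \<open>auto intro!: tendsto_intros * sub w' q'\<close>)
  ultimately show ?thesis using m mq by blast
qed

text \<open>A composition is a projection of a closed set along the intermediate variable; boundedness of that
variable keeps it closed.\<close>

lemma closed_relcomp_Int:
  fixes C1 :: "('a::metric_space \<times> 'b::heine_borel) set" and C2 :: "('b \<times> 'c::metric_space) set"
  assumes cl: "closed C1" "closed C2" "closed F"
    and bd: "bounded {w. \<exists>(x, u)\<in>F. (x, w) \<in> C1 \<and> (w, u) \<in> C2}"
  shows "closed ((C1 O C2) \<inter> F)"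
  unfolding closed_sequential_limits
proof (intro allI impI, elim conjE)
  fix zs z assume zs: "\<forall>k. zs k \<in> (C1 O C2) \<inter> F" "zs \<longlonglongrightarrow> z"
  have "\<exists>w. (fst (zs k), w) \<in> C1 \<and> (w, snd (zs k)) \<in> C2" for k
    using zs(1)[rule_format, of k] by force
  then obtain ws where ws: "\<And>k. (fst (zs k), ws k) \<in> C1" "\<And>k. (ws k, snd (zs k)) \<in> C2" by metis
  have "range ws \<subseteq> {w. \<exists>(x, u)\<in>F. (x, w) \<in> C1 \<and> (w, u) \<in> C2}"
    using ws zs(1) by force
  then obtain w r where r: "strict_mono (r :: nat \<Rightarrow> nat)" "(ws \<circ> r) \<longlonglongrightarrow> w"
    using bounded_subset[OF bd] bounded_imp_convergent_subsequence by blast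
  have z: "(zs \<circ> r) \<longlonglongrightarrow> z" by (rule LIMSEQ_subseq_LIMSEQ[OF zs(2) r(1)])
  have "(\<lambda>k. (fst (zs (r k)), ws (r k))) \<longlonglongrightarrow> (fst z, w)" "(\<lambda>k. (ws (r k), snd (zs (r k)))) \<longlonglongrightarrow> (w, snd z)"
    using z r(2) by (auto intro!: tendsto_intros simp: o_def)
  then have "(fst z, w) \<in> C1" "(w, snd z) \<in> C2"
    by (auto intro: closed_sequentially[OF cl(1) ws(1)] closed_sequentially[OF cl(2) ws(2)])
  moreover have "z \<in> F" using closed_sequentially[OF cl(3)] zs by blast
  ultimately show "z \<in> (C1 O C2) \<inter> F" by (cases z) auto
qed

text \<open>Every limiting normal is a limit of proximal normals at nearby points, because \<open>C1 O C2\<close> is locally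
closed. The approximate multipliers of those proximal normals are then passed to the limit.\<close>

lemma normal_cone_relcomp_multiplier:
  fixes C1 :: "('a::euclidean_space \<times> 'b::euclidean_space) set"
    and C2 :: "('b \<times> 'c::euclidean_space) set"
  assumes cl: "closed C1" "closed C2" and Q: "open Q" "(x, u) \<in> Q"
    and bd: "bounded {w. \<exists>(x, u)\<in>Q. (x, w) \<in> C1 \<and> (w, u) \<in> C2}" (is "bounded ?B")
    and n: "(a, b) \<in> normal_cone (C1 O C2) (x, u)"
  shows "\<exists>w l q. l \<ge> 0 \<and> l + norm q = 1 \<and>
     (l *\<^sub>R a, - q) \<in> normal_cone C1 (x, w) \<and> (q, l *\<^sub>R b) \<in> normal_cone C2 (w, u)"
proof -
  let ?C = "C1 O C2"
  obtain \<rho> where \<rho>: "\<rho> > 0" "cball (x, u) \<rho> \<subseteq> Q" using Q open_contains_cball by blast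
  have xu: "(x, u) \<in> ?C" using n by (auto simp: normal_cone_def split: if_splits)
  obtain zs vs where zs: "\<And>k::nat. zs k \<in> ?C" "zs \<longlonglongrightarrow> (x, u)"
      "\<And>k. vs k \<in> regular_normal_cone ?C (zs k)" "vs \<longlonglongrightarrow> (a, b)"
    using n unfolding normal_cone_eq_outer_limit[OF xu] by (rule outer_limitE) blast
  have "\<exists>x' w w' u' a' b' l q q' w0.
     dist x' x \<le> e \<and> dist u' u \<le> e \<and> dist a' a \<le> e \<and> dist b' b \<le> e \<and>
     dist w' w \<le> e \<and> w0 \<in> ?B \<and> dist w w0 \<le> \<rho> \<and> dist q' q \<le> e \<and> l \<ge> 0 \<and> l + norm q = 1 \<and>
     (l *\<^sub>R a', - q) \<in> regular_normal_cone C1 (x', w) \<and>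
     (q', l *\<^sub>R b') \<in> regular_normal_cone C2 (w', u')" if "e > 0" for e
  proof -
    \<comment> \<open>A third for each of the three approximations: of the limiting normal by a regular one, of that by a
      proximal one, and of the multipliers.\<close>
    define \<epsilon> where "\<epsilon> = min e \<rho> / 3"
    have \<epsilon>: "\<epsilon> > 0" "3 * \<epsilon> \<le> e" "3 * \<epsilon> \<le> \<rho>" using that \<rho> by (auto simp: \<epsilon>_def)
    have "eventually (\<lambda>k. dist (zs k) (x, u) < \<epsilon> \<and> dist (vs k) (a, b) < \<epsilon>) sequentially"
      using tendstoD[OF zs(2) \<epsilon>(1)] tendstoD[OF zs(4) \<epsilon>(1)] by eventually_elim auto
    then obtain k where k: "dist (zs k) (x, u) < \<epsilon>" "dist (vs k) (a, b) < \<epsilon>"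
      using eventually_happens by force
    have sub: "cball (zs k) \<epsilon> \<subseteq> Q"
    proof
      fix y assume "y \<in> cball (zs k) \<epsilon>"
      then have "dist y (x, u) \<le> \<rho>" using k(1) \<epsilon> dist_triangle[of y "(x, u)" "zs k"] by (auto simp: dist_commute)
      then show "y \<in> Q" using \<rho>(2) by (auto simp: dist_commute)
    qed
    have "closed (?C \<inter> cball (zs k) \<epsilon>)"
      by (rule closed_relcomp_Int[OF cl closed_cball], rule bounded_subset[OF bd]) (use sub in blast)
    then obtain z' v' where z': "proximal_normal ?C z' v'" "dist z' (zs k) \<le> \<epsilon>" "dist v' (vs k) \<le> \<epsilon>"
      using regular_normal_approx_proximal[OF zs(3) \<epsilon>(1) _ \<epsilon>(1)] by blast
    obtain x0 u0 where [simp]: "z' = (x0, u0)" by (cases z')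
    obtain a0 b0 where [simp]: "v' = (a0, b0)" by (cases v')
    have "z' \<in> Q" using sub z'(2) by (auto simp: dist_commute)
    moreover have "z' \<in> ?C" using z'(1) by (simp add: proximal_normal_def)
    ultimately obtain w0 where w0: "(x0, w0) \<in> C1" "(w0, u0) \<in> C2" "w0 \<in> ?B" by auto
    have "dist (x0, u0) (x, u) \<le> 2 * \<epsilon>" "dist (a0, b0) (a, b) \<le> 2 * \<epsilon>"
      using z' k dist_triangle[of z' "(x, u)" "zs k"] dist_triangle[of v' "(a, b)" "vs k"] by auto
    then have d0: "dist x0 x \<le> 2 * \<epsilon>" "dist u0 u \<le> 2 * \<epsilon>" "dist a0 a \<le> 2 * \<epsilon>" "dist b0 b \<le> 2 * \<epsilon>"
      using dist_fst_le[of "(x0, u0)" "(x, u)"] dist_snd_le[of "(x0, u0)" "(x, u)"]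
        dist_fst_le[of "(a0, b0)" "(a, b)"] dist_snd_le[of "(a0, b0)" "(a, b)"] by auto
    from proximal_normal_relcomp_fuzzy[OF cl w0(1,2) _ \<epsilon>(1), of a0 b0] z'(1)
    obtain x' w w' u' a' b' l q q' where f:
      "dist x' x0 \<le> \<epsilon>" "dist w w0 \<le> \<epsilon>" "dist w' w0 \<le> \<epsilon>" "dist u' u0 \<le> \<epsilon>"
      "dist a' a0 \<le> \<epsilon>" "dist b' b0 \<le> \<epsilon>" "dist q' q \<le> \<epsilon>" "l \<ge> 0" "l + norm q = 1"
      "(l *\<^sub>R a', - q) \<in> regular_normal_cone C1 (x', w)"
      "(q', l *\<^sub>R b') \<in> regular_normal_cone C2 (w', u')" by auto
    have "dist x' x \<le> e" "dist u' u \<le> e" "dist a' a \<le> e" "dist b' b \<le> e"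
      "dist w' w \<le> e" "dist w w0 \<le> \<rho>" "dist q' q \<le> e"
      using f(1-7) d0 \<epsilon> dist_triangle[of x' x x0] dist_triangle[of u' u u0] dist_triangle[of a' a a0]
        dist_triangle[of b' b b0] dist_triangle2[of w' w w0] by linarith+
    then show ?thesis using f(8-11) w0(3) by blast
  qed
  from this[of "inverse (real (Suc _))"]
  have "\<forall>k. \<exists>x' w w' u' a' b' l q q' w0. let e = inverse (real (Suc k)) in
     dist x' x \<le> e \<and> dist u' u \<le> e \<and> dist a' a \<le> e \<and> dist b' b \<le> e \<and>
     dist w' w \<le> e \<and> w0 \<in> ?B \<and> dist w w0 \<le> \<rho> \<and> dist q' q \<le> e \<and> l \<ge> 0 \<and> l + norm q = 1 \<and>
     (l *\<^sub>R a', - q) \<in> regular_normal_cone C1 (x', w) \<and>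
     (q', l *\<^sub>R b') \<in> regular_normal_cone C2 (w', u')"
    unfolding Let_def by (simp del: of_nat_Suc)
  then obtain X W W' U A B l Q' Q'' W0 where seq: "\<And>k.
     dist (X k) x \<le> inverse (real (Suc k)) \<and> dist (U k) u \<le> inverse (real (Suc k)) \<and>
     dist (A k) a \<le> inverse (real (Suc k)) \<and> dist (B k) b \<le> inverse (real (Suc k)) \<and>
     dist (W' k) (W k) \<le> inverse (real (Suc k)) \<and> W0 k \<in> ?B \<and> dist (W k) (W0 k) \<le> \<rho> \<and>
     dist (Q'' k) (Q' k) \<le> inverse (real (Suc k)) \<and> l k \<ge> 0 \<and> l k + norm (Q' k) = 1 \<and>
     (l k *\<^sub>R A k, - Q' k) \<in> regular_normal_cone C1 (X k, W k) \<and>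
     (Q'' k, l k *\<^sub>R B k) \<in> regular_normal_cone C2 (W' k, U k)"
    unfolding Let_def choice_iff by blast
  have z: "f \<longlonglongrightarrow> 0" if "\<And>k. \<bar>f k\<bar> \<le> inverse (real (Suc k))" for f :: "nat \<Rightarrow> real"
    by (rule Lim_null_comparison[OF _ LIMSEQ_inverse_real_of_nat]) (use that in \<open>simp del: of_nat_Suc\<close>)
  have c: "f \<longlonglongrightarrow> y" if "\<And>k. dist (f k) y \<le> inverse (real (Suc k))" for f :: "nat \<Rightarrow> 'z::metric_space" and y
    by (rule dist_le_inverse_Suc_imp_LIMSEQ[OF tendsto_const that])
  obtain R where R: "\<And>w. w \<in> ?B \<Longrightarrow> norm w \<le> R" using bd unfolding bounded_iff by blast
  have "norm (W k) \<le> \<rho> + R" for k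
    using seq[of k] R[of "W0 k"] norm_triangle_sub[of "W k" "W0 k"] by (simp add: dist_norm)
  then have "bounded (range W)" unfolding bounded_iff by auto
  have "\<exists>w m q. m \<ge> 0 \<and> m + norm q = 1 \<and>
     (m *\<^sub>R a, - q) \<in> outer_limit (regular_normal_cone C1) C1 (x, w) \<and>
     (q, m *\<^sub>R b) \<in> outer_limit (regular_normal_cone C2) C2 (w, u)"
  proof (rule multiplier_compactness[where l = l and as = A and bs = B])
    show "(X k, W k) \<in> C1" "(W' k, U k) \<in> C2" for k
      using seq[of k] unfolding regular_normal_cone_iff by blast+
    show "X \<longlonglongrightarrow> x" "U \<longlonglongrightarrow> u" "A \<longlonglongrightarrow> a" "B \<longlonglongrightarrow> b"
      "(\<lambda>k. dist (W' k) (W k)) \<longlonglongrightarrow> 0" "(\<lambda>k. dist (Q'' k) (Q' k)) \<longlonglongrightarrow> 0"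
      by (intro c z; use seq in \<open>simp del: of_nat_Suc\<close>)+
  qed (use seq \<open>bounded (range W)\<close> in auto)
  then show ?thesis
    using normal_cone_eq_outer_limit outer_limit_imp_mem_closed cl by metis
qed

section \<open>Projections of normal cones\<close>

lemma proj_iff: "y \<in> proj C x \<longleftrightarrow> y \<in> C \<and> (\<forall>z\<in>C. norm (y - x) \<le> norm (z - x))"
proof
  assume "y \<in> proj C x"
  then show "y \<in> C \<and> (\<forall>z\<in>C. norm (y - x) \<le> norm (z - x))"
    using infdist_le[of _ C x] by (auto simp: proj_def dist_norm norm_minus_commute)
next
  assume y: "y \<in> C \<and> (\<forall>z\<in>C. norm (y - x) \<le> norm (z - x))"
  then have "norm (y - x) \<le> infdist x C"
    unfolding infdist_notempty[OF ex_in_conv[THEN iffD1, OF exI, OF conjunct1[OF y]]]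
    by (intro cINF_greatest) (auto simp: dist_norm norm_minus_commute)
  moreover have "infdist x C \<le> norm (y - x)"
    using y infdist_le[of y C x] by (simp add: dist_norm norm_minus_commute)
  ultimately show "y \<in> proj C x" using y by (simp add: proj_def)
qed

lemma proj_Times_UNIV_iff:
  "(t, c) \<in> proj (T \<times> UNIV) (a, b) \<longleftrightarrow> t \<in> proj T a \<and> c = b"
proof
  assume L: "(t, c) \<in> proj (T \<times> UNIV) (a, b)"
  then have t: "t \<in> T" unfolding proj_iff by simp
  have n: "norm (t - a, c - b) \<le> norm (z - a, d - b)" if "z \<in> T" for z d
    using L that unfolding proj_iff by (metis UNIV_I diff_Pair mem_Sigma_iff)
  have "(norm (t - a))\<^sup>2 + (norm (c - b))\<^sup>2 \<le> (norm (t - a))\<^sup>2"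
    using n[OF t, of b] power_mono[OF n[OF t, of b], of 2] by (simp add: norm_prod_def)
  then have c: "c = b" by simp
  have "norm (t - a) \<le> norm (z - a)" if "z \<in> T" for z
    using n[OF that, of b] c by (simp add: norm_prod_def)
  then show "t \<in> proj T a \<and> c = b" using t c by (simp add: proj_iff)
next
  assume "t \<in> proj T a \<and> c = b"
  then show "(t, c) \<in> proj (T \<times> UNIV) (a, b)"
    by (auto simp: proj_iff norm_prod_def intro: order_trans)
qed

lemma proj_cone_scale:
  assumes "cone T" "t \<in> proj T a" "l \<ge> 0"
  shows "l *\<^sub>R t \<in> proj T (l *\<^sub>R a)"
proof (cases "l = 0")
  case True
  have "0 \<in> T" using assms(1,2) by (metis cone_def order_refl proj_iff scaleR_zero_left)
  then show ?thesis using True by (simp add: proj_iff)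
next
  case False
  then have l: "l > 0" using assms by simp
  show ?thesis unfolding proj_iff
  proof (intro conjI ballI)
    show "l *\<^sub>R t \<in> T" using assms by (simp add: cone_def proj_iff)
    fix z assume "z \<in> T"
    then have "(1 / l) *\<^sub>R z \<in> T" using assms(1) l by (simp add: cone_def)
    then have "norm (t - a) \<le> norm ((1 / l) *\<^sub>R z - a)" using assms(2) by (simp add: proj_iff)
    then have "l * norm (t - a) \<le> l * norm ((1 / l) *\<^sub>R z - a)" using l by simp
    also have "\<dots> = norm (l *\<^sub>R ((1 / l) *\<^sub>R z - a))" using l by simp
    also have "l *\<^sub>R ((1 / l) *\<^sub>R z - a) = z - l *\<^sub>R a" using l by (simp add: scaleR_diff_right)
    finally show "norm (l *\<^sub>R t - l *\<^sub>R a) \<le> norm (z - l *\<^sub>R a)"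
      using l by (simp add: scaleR_diff_right[symmetric])
  qed
qed

lemma zero_in_tangent_cone:
  assumes "x \<in> X"
  shows "0 \<in> tangent_cone X x"
proof -
  have "0 \<in> outer_limit (\<lambda>t::real. (\<lambda>y. (y - x) /\<^sub>R t) ` X) {0<..} 0"
    by (rule outer_limitI[where xs = "\<lambda>k. inverse (real (Suc k))" and us = "\<lambda>_. 0"])
      (use assms LIMSEQ_inverse_real_of_nat in \<open>auto intro!: image_eqI[where x = x] simp del: of_nat_Suc\<close>)
  then show ?thesis using assms by (simp add: tangent_cone_def)
qed

lemma cone_tangent_cone: "cone (tangent_cone X x)"
  unfolding cone_def
proof (intro ballI allI impI)
  fix h and c :: real assume h: "h \<in> tangent_cone X x" and c: "c \<ge> 0"
  then have x: "x \<in> X" by (auto simp: tangent_cone_def split: if_splits)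
  show "c *\<^sub>R h \<in> tangent_cone X x"
  proof (cases "c = 0")
    case True
    then show ?thesis using zero_in_tangent_cone[OF x] by simp
  next
    case False
    then have c: "c > 0" using c by simp
    have "h \<in> outer_limit (\<lambda>t::real. (\<lambda>y. (y - x) /\<^sub>R t) ` X) {0<..} 0"
      using h x by (simp add: tangent_cone_def)
    then obtain ts hs where *: "\<And>k::nat. ts k \<in> {0<..}" "ts \<longlonglongrightarrow> 0"
        "\<And>k. hs k \<in> (\<lambda>y. (y - x) /\<^sub>R ts k) ` X" "hs \<longlonglongrightarrow> h"
      by (rule outer_limitE) blast
    have "c *\<^sub>R hs k \<in> (\<lambda>y. (y - x) /\<^sub>R (ts k / c)) ` X" for k
    proof -
      obtain y where "y \<in> X" "hs k = (y - x) /\<^sub>R ts k" using *(3)[of k] by blast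
      then have "c *\<^sub>R hs k = (y - x) /\<^sub>R (ts k / c)" using c by (simp add: divide_inverse mult.commute)
      then show ?thesis using \<open>y \<in> X\<close> by blast
    qed
    moreover have "(\<lambda>k. ts k / c) \<longlonglongrightarrow> 0" using tendsto_divide[OF *(2) tendsto_const] c by fastforce
    moreover have "(\<lambda>k. c *\<^sub>R hs k) \<longlonglongrightarrow> c *\<^sub>R h" by (intro tendsto_intros *)
    ultimately have "c *\<^sub>R h \<in> outer_limit (\<lambda>t::real. (\<lambda>y. (y - x) /\<^sub>R t) ` X) {0<..} 0"
      using * c by (intro outer_limitI[where xs = "\<lambda>k. ts k / c" and us = "\<lambda>k. c *\<^sub>R hs k"]) auto
    then show ?thesis using x by (simp add: tangent_cone_def)
  qed
qed

text \<open>The set whose outer limit along \<open>C = gph (sv_restrict S X)\<close> defines the projectional coderivative.\<close>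

definition projected_normal_cone ::
  "'a::real_inner set \<Rightarrow> ('a \<times> 'b::real_inner) set \<Rightarrow> 'a \<times> 'b \<Rightarrow> ('a \<times> 'b) set" where
  "projected_normal_cone X C z = proj_set (tangent_cone X (fst z) \<times> UNIV) (normal_cone C z)"

lemma projected_normal_cone_iff:
  "(t, b) \<in> projected_normal_cone X C (x, u) \<longleftrightarrow>
     (\<exists>a. (a, b) \<in> normal_cone C (x, u) \<and> t \<in> proj (tangent_cone X x) a)"
  unfolding projected_normal_cone_def proj_set_def by (force simp: proj_Times_UNIV_iff)

lemma projected_normal_cone_scale:
  assumes "p \<in> projected_normal_cone X C z" "l \<ge> 0"
  shows "l *\<^sub>R p \<in> projected_normal_cone X C z"
proof -
  obtain t b x u where [simp]: "p = (t, b)" "z = (x, u)" by (metis surj_pair)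
  obtain a where a: "(a, b) \<in> normal_cone C (x, u)" "t \<in> proj (tangent_cone X x) a"
    using assms(1) by (auto simp: projected_normal_cone_iff)
  have "(l *\<^sub>R a, l *\<^sub>R b) \<in> normal_cone C (x, u)"
    using normal_cone_scale[OF a(1) assms(2)] by simp
  moreover have "l *\<^sub>R t \<in> proj (tangent_cone X x) (l *\<^sub>R a)"
    by (rule proj_cone_scale[OF cone_tangent_cone a(2) assms(2)])
  ultimately show ?thesis by (auto simp: projected_normal_cone_iff)
qed

lemma outer_limit_scale:
  fixes K :: "'a::topological_space \<Rightarrow> 'b::real_normed_vector set"
  assumes "v \<in> outer_limit K D x" "\<And>z v. v \<in> K z \<Longrightarrow> l *\<^sub>R v \<in> K z"
  shows "l *\<^sub>R v \<in> outer_limit K D x"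
proof -
  obtain xs vs where *: "\<And>k::nat. xs k \<in> D" "xs \<longlonglongrightarrow> x" "\<And>k. vs k \<in> K (xs k)" "vs \<longlonglongrightarrow> v"
    using assms(1) by (rule outer_limitE) blast
  show ?thesis
    by (rule outer_limitI[where xs = xs and us = "\<lambda>k. l *\<^sub>R vs k"])
      (use * assms(2) in \<open>auto intro!: tendsto_intros\<close>)
qed

text \<open>Choose unprojected normals and apply the multiplier rule to them at each point of the sequence. The
unprojected first components may be unbounded, but only their projections, which converge, enter the
limit; the multipliers are normalised whatever the size of those components.\<close>

lemma projected_normal_relcomp_multiplier:
  fixes C1 :: "('a::euclidean_space \<times> 'b::euclidean_space) set"
    and C2 :: "('b \<times> 'c::euclidean_space) set"
  assumes cl: "closed C1" "closed C2" and Q: "open Q" "(x, u) \<in> Q"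
    and bd: "bounded {w. \<exists>(x, u)\<in>Q. (x, w) \<in> C1 \<and> (w, u) \<in> C2}" (is "bounded ?B")
    and n: "(t, b) \<in> outer_limit (projected_normal_cone X (C1 O C2)) (C1 O C2) (x, u)"
  shows "\<exists>w l q. l \<ge> 0 \<and> l + norm q = 1 \<and>
     (l *\<^sub>R t, - q) \<in> outer_limit (projected_normal_cone X C1) C1 (x, w) \<and>
     (q, l *\<^sub>R b) \<in> normal_cone C2 (w, u)"
proof -
  obtain zs vs where zs: "\<And>k::nat. zs k \<in> C1 O C2" "zs \<longlonglongrightarrow> (x, u)"
      "\<And>k. vs k \<in> projected_normal_cone X (C1 O C2) (zs k)" "vs \<longlonglongrightarrow> (t, b)"
    using n by (rule outer_limitE) blast
  have "eventually (\<lambda>k. zs k \<in> Q) sequentially" by (rule topological_tendstoD[OF zs(2) Q])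
  then obtain N where N: "\<And>k. k \<ge> N \<Longrightarrow> zs k \<in> Q" by (auto simp: eventually_sequentially)
  \<comment> \<open>Shift the sequences so that every point lies in the neighbourhood \<open>Q\<close>.\<close>
  define xs us ts bs where defs: "xs = (\<lambda>k. fst (zs (k + N)))" "us = (\<lambda>k. snd (zs (k + N)))"
    "ts = (\<lambda>k. fst (vs (k + N)))" "bs = (\<lambda>k. snd (vs (k + N)))"
  have lim: "xs \<longlonglongrightarrow> x" "us \<longlonglongrightarrow> u" "ts \<longlonglongrightarrow> t" "bs \<longlonglongrightarrow> b"
    unfolding defs using LIMSEQ_ignore_initial_segment[OF zs(2), of N, THEN tendsto_fst]
      LIMSEQ_ignore_initial_segment[OF zs(2), of N, THEN tendsto_snd]
      LIMSEQ_ignore_initial_segment[OF zs(4), of N, THEN tendsto_fst]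
      LIMSEQ_ignore_initial_segment[OF zs(4), of N, THEN tendsto_snd] by simp_all
  have "\<exists>w l q. l \<ge> 0 \<and> l + norm q = 1 \<and> w \<in> ?B \<and>
     (l *\<^sub>R ts k, - q) \<in> projected_normal_cone X C1 (xs k, w) \<and> (xs k, w) \<in> C1 \<and>
     (q, l *\<^sub>R bs k) \<in> normal_cone C2 (w, us k) \<and> (w, us k) \<in> C2" for k
  proof -
    have "(ts k, bs k) \<in> projected_normal_cone X (C1 O C2) (xs k, us k)"
      using zs(3)[of "k + N"] by (simp add: defs)
    then obtain a where a: "(a, bs k) \<in> normal_cone (C1 O C2) (xs k, us k)"
        "ts k \<in> proj (tangent_cone X (xs k)) a"
      by (auto simp: projected_normal_cone_iff)
    have Qk: "(xs k, us k) \<in> Q" using N[of "k + N"] by (simp add: defs)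
    from normal_cone_relcomp_multiplier[OF cl Q(1) Qk bd a(1)]
    obtain w l q where w: "l \<ge> 0" "l + norm q = 1" "(l *\<^sub>R a, - q) \<in> normal_cone C1 (xs k, w)"
        "(q, l *\<^sub>R bs k) \<in> normal_cone C2 (w, us k)" by blast
    have "(xs k, w) \<in> C1" "(w, us k) \<in> C2"
      using w(3,4) by (auto simp: normal_cone_def split: if_splits)
    moreover have "(l *\<^sub>R ts k, - q) \<in> projected_normal_cone X C1 (xs k, w)"
      using proj_cone_scale[OF cone_tangent_cone a(2) w(1)] w(3) by (auto simp: projected_normal_cone_iff)
    ultimately show ?thesis using w Qk by blast
  qed
  then have "\<forall>k. \<exists>w l q. l \<ge> 0 \<and> l + norm q = 1 \<and> w \<in> ?B \<and>
     (l *\<^sub>R ts k, - q) \<in> projected_normal_cone X C1 (xs k, w) \<and> (xs k, w) \<in> C1 \<and>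
     (q, l *\<^sub>R bs k) \<in> normal_cone C2 (w, us k) \<and> (w, us k) \<in> C2" ..
  then obtain ws l qs where *: "\<And>k. l k \<ge> 0 \<and> l k + norm (qs k) = 1 \<and> ws k \<in> ?B \<and>
     (l k *\<^sub>R ts k, - qs k) \<in> projected_normal_cone X C1 (xs k, ws k) \<and> (xs k, ws k) \<in> C1 \<and>
     (qs k, l k *\<^sub>R bs k) \<in> normal_cone C2 (ws k, us k) \<and> (ws k, us k) \<in> C2"
    unfolding choice_iff by blast
  have "bounded (range ws)" by (rule bounded_subset[OF bd]) (use * in blast)
  have "\<exists>w m q. m \<ge> 0 \<and> m + norm q = 1 \<and>
     (m *\<^sub>R t, - q) \<in> outer_limit (projected_normal_cone X C1) C1 (x, w) \<and>
     (q, m *\<^sub>R b) \<in> outer_limit (normal_cone C2) C2 (w, u)"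
    by (rule multiplier_compactness[where l = l and as = ts and bs = bs and xs = xs and us = us
          and qs = qs and qs' = qs and ws = ws and ws' = ws, OF _ _ lim _ _ \<open>bounded (range ws)\<close>])
      (simp_all add: *)
  then show ?thesis
    using normal_cone_outer_limit_subset outer_limit_imp_mem_closed cl(2) by metis
qed

section \<open>Lipschitz-like mappings\<close>

text \<open>Move from \<open>w\<close> to \<open>w + t v\<close> and follow the mapping, which costs at most \<open>\<kappa> t (norm v)\<close> in the image. For
regular normals \<open>(v, c)\<close> this gives \<open>norm v \<le> \<kappa> * norm c\<close>, and the bound passes to limiting normals.\<close>

lemma lipschitz_like_imp_normal_zero:
  assumes L: "lipschitz_like S wb ub" and n: "(v, 0) \<in> normal_cone (gph S) (wb, ub)"
  shows "v = 0"
proof -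
  obtain V W \<kappa> where V: "wb \<in> interior V" "ub \<in> interior W" "\<kappa> \<ge> 0"
    and lip: "\<And>x x'. x \<in> V \<Longrightarrow> x' \<in> V \<Longrightarrow>
        S x' \<inter> W \<subseteq> {u + (\<kappa> * norm (x' - x)) *\<^sub>R b | u b. u \<in> S x \<and> b \<in> cball 0 1}"
    using L unfolding lipschitz_like_def by blast
  have reg: "norm v \<le> \<kappa> * norm c"
    if n: "(v, c) \<in> regular_normal_cone (gph S) (w, u)" and wu: "w \<in> interior V" "u \<in> interior W" for v c w u
  proof (cases "v = 0")
    case False
    have "norm v \<le> \<kappa> * norm c + e" if "e > 0" for e
    proof -
      define e' where "e' = e / (1 + \<kappa>)"
      have e': "e' > 0" "e' * (1 + \<kappa>) = e" using \<open>e > 0\<close> V(3) by (auto simp: e'_def)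
      have u: "u \<in> S w" using n unfolding regular_normal_cone_iff by (simp add: gph_def)
      obtain d where d: "d > 0" "\<And>y. y \<in> gph S \<Longrightarrow> dist y (w, u) < d \<Longrightarrow>
          (v, c) \<bullet> (y - (w, u)) \<le> e' * norm (y - (w, u))"
        using n e'(1) unfolding regular_normal_cone_iff by blast
      obtain r where r: "r > 0" "ball w r \<subseteq> V" using wu(1) mem_interior by blast
      define t where "t = min (r / 2) (d / (2 * (1 + \<kappa>))) / norm v"
      have t: "t > 0" using r d V(3) False by (simp add: t_def)
      have tv: "norm (t *\<^sub>R v) = min (r / 2) (d / (2 * (1 + \<kappa>)))"
        using r d V(3) False by (simp add: t_def)
      have tv1: "norm (t *\<^sub>R v) < r" using tv r by simp
      have "norm (t *\<^sub>R v) \<le> d / (2 * (1 + \<kappa>))" using tv by simp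
      then have tv2: "(1 + \<kappa>) * norm (t *\<^sub>R v) < d" using d V(3) by (simp add: field_simps)
      have "w + t *\<^sub>R v \<in> V" using r(2) tv1 by (auto simp: dist_norm)
      moreover have "w \<in> V" "u \<in> W" using wu interior_subset by blast+
      ultimately have "u \<in> {u' + (\<kappa> * norm (w - (w + t *\<^sub>R v))) *\<^sub>R b | u' b. u' \<in> S (w + t *\<^sub>R v) \<and> b \<in> cball 0 1}"
        using lip[of "w + t *\<^sub>R v" w] u by blast
      then obtain u' p where u': "u' \<in> S (w + t *\<^sub>R v)" "norm p \<le> 1" "u = u' + (\<kappa> * norm (t *\<^sub>R v)) *\<^sub>R p"
        by auto
      have "norm (u' - u) = \<kappa> * norm (t *\<^sub>R v) * norm p"
        using u'(3) V(3) by (simp add: abs_mult)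
      also have "\<dots> \<le> \<kappa> * norm (t *\<^sub>R v) * 1" using u'(2) V(3) by (intro mult_left_mono) auto
      finally have nu: "norm (u' - u) \<le> \<kappa> * norm (t *\<^sub>R v)" by simp
      have "norm (t *\<^sub>R v, u' - u) \<le> norm (t *\<^sub>R v) + norm (u' - u)" by (rule norm_Pair_le)
      also have "\<dots> \<le> (1 + \<kappa>) * norm (t *\<^sub>R v)" using nu by (simp add: algebra_simps)
      finally have nb: "norm (t *\<^sub>R v, u' - u) \<le> (1 + \<kappa>) * norm (t *\<^sub>R v)" .
      have "(v, c) \<bullet> ((w + t *\<^sub>R v, u') - (w, u)) \<le> e' * norm ((w + t *\<^sub>R v, u') - (w, u))"
        by (rule d(2)) (use u'(1) nb tv2 in \<open>auto simp: gph_def dist_norm\<close>)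
      then have "v \<bullet> (t *\<^sub>R v) + c \<bullet> (u' - u) \<le> e' * norm (t *\<^sub>R v, u' - u)" by simp
      also have "\<dots> \<le> e' * ((1 + \<kappa>) * norm (t *\<^sub>R v))" using nb e' by (intro mult_left_mono) auto
      also have "\<dots> = e * norm (t *\<^sub>R v)" using e'(2) by (simp add: mult.assoc[symmetric])
      finally have 1: "v \<bullet> (t *\<^sub>R v) + c \<bullet> (u' - u) \<le> e * norm (t *\<^sub>R v)" .
      have "\<bar>c \<bullet> (u' - u)\<bar> \<le> norm c * norm (u' - u)" by (rule Cauchy_Schwarz_ineq2)
      also have "\<dots> \<le> norm c * (\<kappa> * norm (t *\<^sub>R v))" using nu by (intro mult_left_mono) auto
      finally have "norm v * norm (t *\<^sub>R v) \<le> (\<kappa> * norm c + e) * norm (t *\<^sub>R v)"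
        using 1 t by (simp add: algebra_simps power2_norm_eq_inner[symmetric] power2_eq_square)
      then show ?thesis using t False by simp
    qed
    then show ?thesis using field_le_epsilon by blast
  qed (use V in simp)
  have "(wb, ub) \<in> gph S" using n by (auto simp: normal_cone_def split: if_splits)
  with n obtain zs vs where zs: "zs \<longlonglongrightarrow> (wb, ub)"
      "\<And>k::nat. vs k \<in> regular_normal_cone (gph S) (zs k)" "vs \<longlonglongrightarrow> (v, 0)"
    unfolding normal_cone_eq_outer_limit[OF \<open>(wb, ub) \<in> gph S\<close>] by (elim outer_limitE) blast
  have "eventually (\<lambda>k. fst (zs k) \<in> interior V \<and> snd (zs k) \<in> interior W) sequentially"
    using topological_tendstoD[OF tendsto_fst[OF zs(1)] open_interior, of V]
      topological_tendstoD[OF tendsto_snd[OF zs(1)] open_interior, of W] V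
    by (auto intro: eventually_conj)
  then have "eventually (\<lambda>k. norm (fst (vs k)) \<le> \<kappa> * norm (snd (vs k))) sequentially"
    by eventually_elim (use reg zs(2) in \<open>metis prod.collapse\<close>)
  moreover have "(\<lambda>k. norm (fst (vs k))) \<longlonglongrightarrow> norm v"
    using tendsto_norm[OF tendsto_fst[OF zs(3)]] by simp
  moreover have "(\<lambda>k. \<kappa> * norm (snd (vs k))) \<longlonglongrightarrow> 0"
    using tendsto_mult_left[OF tendsto_norm[OF tendsto_snd[OF zs(3)]], of \<kappa>] by simp
  ultimately have "norm v \<le> 0" by (intro tendsto_le[OF sequentially_bot])
  then show ?thesis by simp
qed

section \<open>Convex sets and smooth manifolds\<close>

text \<open>A regular normal inequality at \<open>z\<close> is tested along the segment to \<open>y\<close>, where both sides scale with the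
parameter; the resulting inequality is stable under limits.\<close>

lemma normal_cone_convex_iff:
  assumes C: "convex C"
  shows "v \<in> normal_cone C z \<longleftrightarrow> z \<in> C \<and> (\<forall>y\<in>C. v \<bullet> (y - z) \<le> 0)"
proof
  assume R: "z \<in> C \<and> (\<forall>y\<in>C. v \<bullet> (y - z) \<le> 0)"
  then have "v \<in> regular_normal_cone C z"
    unfolding regular_normal_cone_iff by (auto intro!: exI[of _ 1] intro: order_trans)
  then show "v \<in> normal_cone C z"
    using R by (simp add: normal_cone_eq_outer_limit outer_limit_self)
next
  have reg: "v \<bullet> (y - z) \<le> 0" if v: "v \<in> regular_normal_cone C z" and y: "y \<in> C" for v z y
  proof (rule field_le_epsilon)
    fix e :: real assume "e > 0"
    define n where "n = norm (y - z) + 1"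
    have n: "n > 0" "norm (y - z) \<le> n" by (auto simp: n_def add_nonneg_pos)
    have "e / n > 0" using \<open>e > 0\<close> n by simp
    then obtain d where d: "d > 0"
      "\<And>y. y \<in> C \<Longrightarrow> dist y z < d \<Longrightarrow> v \<bullet> (y - z) \<le> e / n * norm (y - z)"
      using v unfolding regular_normal_cone_iff by blast
    define t where "t = min 1 (d / (2 * n))"
    have t: "t > 0" "t \<le> 1" using d n by (auto simp: t_def)
    have "t * norm (y - z) \<le> d / (2 * n) * n" using t n by (intro mult_mono) (auto simp: t_def)
    also have "\<dots> < d" using d n by simp
    finally have "dist (z + t *\<^sub>R (y - z)) z < d" using t by (simp add: dist_norm)
    moreover have "z + t *\<^sub>R (y - z) \<in> C"
      using convexD_alt[OF C, of z y t] v y t unfolding regular_normal_cone_iff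
      by (simp add: algebra_simps)
    ultimately have "v \<bullet> (t *\<^sub>R (y - z)) \<le> e / n * norm (t *\<^sub>R (y - z))"
      using d(2)[of "z + t *\<^sub>R (y - z)"] by simp
    then have "t * (v \<bullet> (y - z)) \<le> t * (e / n * norm (y - z))" using t by (simp add: mult.left_commute)
    then have "v \<bullet> (y - z) \<le> e / n * norm (y - z)"
      by (rule mult_left_le_imp_le) (use t in simp)
    also have "\<dots> \<le> e / n * n" using n \<open>e / n > 0\<close> by (intro mult_left_mono) auto
    also have "\<dots> = 0 + e" using n by simp
    finally show "v \<bullet> (y - z) \<le> 0 + e" .
  qed
  assume v: "v \<in> normal_cone C z"
  then have z: "z \<in> C" by (auto simp: normal_cone_def split: if_splits)
  then obtain zs vs where zs: "zs \<longlonglongrightarrow> z" "\<And>k::nat. vs k \<in> regular_normal_cone C (zs k)" "vs \<longlonglongrightarrow> v"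
    using v unfolding normal_cone_eq_outer_limit[OF z] by (elim outer_limitE) blast
  have "v \<bullet> (y - z) \<le> 0" if "y \<in> C" for y
  proof (rule LIMSEQ_le_const2)
    show "(\<lambda>k. vs k \<bullet> (y - zs k)) \<longlonglongrightarrow> v \<bullet> (y - z)" by (intro tendsto_intros zs)
  qed (use reg[OF zs(2) that] in blast)
  then show "z \<in> C \<and> (\<forall>y\<in>C. v \<bullet> (y - z) \<le> 0)" using z by blast
qed

lemma tangent_cone_curve:
  assumes X: "\<forall>\<^sub>F s in at_right 0. \<gamma> s \<in> X" and d: "(\<gamma> has_vector_derivative h) (at_right 0)"
    and x: "\<gamma> 0 = x" "x \<in> X"
  shows "h \<in> tangent_cone X x"
proof -
  define ts where "ts k = inverse (real (Suc k))" for k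
  have ts: "ts \<longlonglongrightarrow> 0" "\<And>k. ts k > 0"
    unfolding ts_def by (rule LIMSEQ_inverse_real_of_nat) simp
  have fl: "filterlim ts (at_right 0) sequentially"
    unfolding filterlim_at using ts by (auto intro!: always_eventually simp: less_imp_neq[THEN not_sym])
  obtain N where N: "\<And>k. k \<ge> N \<Longrightarrow> \<gamma> (ts k) \<in> X"
    using eventually_compose_filterlim[OF X fl] by (auto simp: eventually_sequentially)
  have "((\<lambda>s. norm ((\<gamma> s - x) /\<^sub>R s - h)) \<longlongrightarrow> 0) (at_right 0)"
  proof (rule Lim_transform_eventually)
    show "((\<lambda>s. norm (\<gamma> s - \<gamma> 0 - (s - 0) *\<^sub>R h) / norm (s - 0)) \<longlongrightarrow> 0) (at_right 0)"
      using d unfolding has_vector_derivative_def has_derivative_iff_norm by blast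
    show "\<forall>\<^sub>F s in at_right 0. norm (\<gamma> s - \<gamma> 0 - (s - 0) *\<^sub>R h) / norm (s - 0) = norm ((\<gamma> s - x) /\<^sub>R s - h)"
    proof (rule eventually_at_rightI[of 0 1])
      fix s :: real assume "s \<in> {0<..<1}"
      then have s: "s > 0" by simp
      have "norm ((\<gamma> s - x) /\<^sub>R s - h) = norm ((\<gamma> s - x - s *\<^sub>R h) /\<^sub>R s)"
        using s by (simp add: scaleR_diff_right)
      then show "norm (\<gamma> s - \<gamma> 0 - (s - 0) *\<^sub>R h) / norm (s - 0) = norm ((\<gamma> s - x) /\<^sub>R s - h)"
        using s x by (simp add: divide_inverse mult.commute)
    qed simp
  qed
  then have "((\<lambda>s. (\<gamma> s - x) /\<^sub>R s) \<longlongrightarrow> h) (at_right 0)"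
    using tendsto_norm_zero_iff LIM_zero_iff by blast
  then have "(\<lambda>k. (\<gamma> (ts k) - x) /\<^sub>R ts k) \<longlonglongrightarrow> h"
    using fl by (rule filterlim_compose)
  then have "(\<lambda>k. (\<gamma> (ts (k + N)) - x) /\<^sub>R ts (k + N)) \<longlonglongrightarrow> h" "(\<lambda>k. ts (k + N)) \<longlonglongrightarrow> 0"
    using LIMSEQ_ignore_initial_segment ts(1) by blast+
  then have "h \<in> outer_limit (\<lambda>t::real. (\<lambda>y. (y - x) /\<^sub>R t) ` X) {0<..} 0"
    by (intro outer_limitI[where xs = "\<lambda>k. ts (k + N)" and us = "\<lambda>k. (\<gamma> (ts (k + N)) - x) /\<^sub>R ts (k + N)"])
      (use ts N in auto)
  then show ?thesis using x by (simp add: tangent_cone_def)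
qed

text \<open>The difference quotients of \<open>F\<close> along a sequence that defines \<open>h\<close> vanish, and they tend to \<open>g \<bullet> h\<close>.\<close>

lemma tangent_cone_level_set:
  assumes h: "h \<in> tangent_cone X x" and U: "open U" "x \<in> U" and F: "\<And>y. y \<in> X \<inter> U \<Longrightarrow> F y = F x"
    and d: "GDERIV F x :> g"
  shows "g \<bullet> h = 0"
proof -
  have x: "x \<in> X" using h by (auto simp: tangent_cone_def split: if_splits)
  then have "h \<in> outer_limit (\<lambda>t::real. (\<lambda>y. (y - x) /\<^sub>R t) ` X) {0<..} 0"
    using h by (simp add: tangent_cone_def)
  then obtain ts hs where *: "\<And>k::nat. ts k \<in> {0<..}" "ts \<longlonglongrightarrow> 0"
      "\<And>k. hs k \<in> (\<lambda>y. (y - x) /\<^sub>R ts k) ` X" "hs \<longlonglongrightarrow> h"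
    by (rule outer_limitE) blast
  have X: "x + ts k *\<^sub>R hs k \<in> X" for k
    using *(1)[of k] *(3)[of k] by auto
  have lim: "(\<lambda>k. x + ts k *\<^sub>R hs k) \<longlonglongrightarrow> x"
    using tendsto_add[OF tendsto_const tendsto_scaleR[OF *(2,4)], of x] by simp
  have "\<bar>g \<bullet> h\<bar> \<le> e * norm h" if "e > 0" for e
  proof -
    obtain \<delta> where \<delta>: "\<delta> > 0" "\<And>y. norm (y - x) < \<delta> \<Longrightarrow> norm (F y - F x - (y - x) \<bullet> g) \<le> e * norm (y - x)"
      using d \<open>e > 0\<close> unfolding gderiv_def has_derivative_at_alt by blast
    have "\<forall>\<^sub>F k in sequentially. \<bar>hs k \<bullet> g\<bar> \<le> e * norm (hs k)"
      using tendstoD[OF lim \<delta>(1)] topological_tendstoD[OF lim U]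
    proof eventually_elim
      case (elim k)
      have "norm (F (x + ts k *\<^sub>R hs k) - F x - (ts k *\<^sub>R hs k) \<bullet> g) \<le> e * norm (ts k *\<^sub>R hs k)"
        using \<delta>(2)[of "x + ts k *\<^sub>R hs k"] elim by (simp add: dist_norm)
      then have "ts k * \<bar>hs k \<bullet> g\<bar> \<le> ts k * (e * norm (hs k))"
        using F[of "x + ts k *\<^sub>R hs k"] X elim *(1)[of k] by (simp add: abs_mult mult.left_commute)
      then show ?case using *(1)[of k] by simp
    qed
    then have "\<bar>h \<bullet> g\<bar> \<le> e * norm h"
      by (intro tendsto_le[OF sequentially_bot, where f = "\<lambda>k. e * norm (hs k)" and g = "\<lambda>k. \<bar>hs k \<bullet> g\<bar>"])
        (auto intro!: tendsto_intros *)
    then show ?thesis by (simp add: inner_commute)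
  qed
  have "\<bar>g \<bullet> h\<bar> \<le> 0 + e" if "e > 0" for e
  proof -
    define n where "n = norm h + 1"
    have n: "n > 0" "norm h \<le> n" by (auto simp: n_def add_nonneg_pos)
    then have "e / n > 0" using that by simp
    then have "\<bar>g \<bullet> h\<bar> \<le> e / n * norm h" by (rule \<open>\<And>e. e > 0 \<Longrightarrow> \<bar>g \<bullet> h\<bar> \<le> e * norm h\<close>)
    also have "\<dots> \<le> e / n * n" using n \<open>e / n > 0\<close> by (intro mult_left_mono) auto
    finally show ?thesis using n by simp
  qed
  then show ?thesis using field_le_epsilon[of "\<bar>g \<bullet> h\<bar>" 0] by simp
qed

lemma independent_family_sum_zero:
  fixes g :: "nat \<Rightarrow> 'a::euclidean_space"
  assumes dim: "dim (g ` {..<m}) = m" and z: "(\<Sum>i<m. c i *\<^sub>R g i) = 0" and i: "i < m"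
  shows "c i = 0"
proof -
  have card: "card (g ` {..<m}) = m"
    using card_image_le[of "{..<m}" g] dim_le_card[of "g ` {..<m}" "g ` {..<m}"] dim
    by (simp add: span_superset)
  have inj: "inj_on g {..<m}" by (rule eq_card_imp_inj_on) (use card in auto)
  have ind: "independent (g ` {..<m})"
    by (rule card_le_dim_spanning[of _ "g ` {..<m}"]) (use card dim in \<open>auto intro: span_base\<close>)
  define f where "f = c \<circ> inv_into {..<m} g"
  have f: "f (g j) = c j" if "j < m" for j using inj that by (simp add: f_def)
  have "(\<Sum>v\<in>g ` {..<m}. f v *\<^sub>R v) = (\<Sum>i<m. c i *\<^sub>R g i)"
    by (simp add: sum.reindex[OF inj] f)
  then have "f (g i) = 0"
    using independentD[OF ind, of "g ` {..<m}" f "g i"] z i by auto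
  then show ?thesis using f[OF i] by simp
qed

text \<open>Complete the components \<open>F i\<close> to local coordinates of the whole space: with \<open>B\<close> a basis of the common
kernel \<open>T\<close> of the gradients \<open>g i\<close> at \<open>xb\<close>, let \<open>\<Phi> y\<close> be the sum of all \<open>F i y *\<^sub>R g i\<close> and all \<open>(b \<bullet> y) *\<^sub>R b\<close>. Its
derivative \<open>L xb\<close> at \<open>xb\<close> is injective, as \<open>L xb h \<bullet> h\<close> is a sum of squares that vanishes only for \<open>h\<close> that
lie in \<open>T\<close> and are orthogonal to \<open>T\<close>. So \<open>\<Phi>\<close> is a local diffeomorphism, and it straightens \<open>X\<close> to \<open>T\<close>. This
single chart describes the tangent spaces at all nearby points.\<close>

lemma tangent_cone_smooth_manifold:
  fixes X :: "'a::euclidean_space set"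
  assumes "smooth_manifold_around d X xb"
  obtains U m G where "open U" "xb \<in> U" "\<And>i. i < m \<Longrightarrow> continuous_on U (G i)"
    "\<And>x. x \<in> X \<inter> U \<Longrightarrow> tangent_cone X x = {h. \<forall>i<m::nat. G i x \<bullet> h = 0}"
proof -
  define m where "m = DIM('a) - d"
  obtain U F G where U: "open U" "xb \<in> U"
    and F: "\<And>i x. i < m \<Longrightarrow> x \<in> U \<Longrightarrow> GDERIV (F i) x :> G i x" and G: "\<And>i. i < m \<Longrightarrow> continuous_on U (G i)"
    and dim: "dim ((\<lambda>i. G i xb) ` {..<m}) = m" and X: "X \<inter> U = {x \<in> U. \<forall>i<m. F i x = (0::real)}"
    using assms unfolding smooth_manifold_around_def m_def[symmetric] by (elim conjE exE) (rule that; simp)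
  define g where "g i = G i xb" for i
  define T where "T = {h. \<forall>i<m. g i \<bullet> h = 0}"
  have T: "subspace T" unfolding T_def subspace_def by (auto simp: inner_add_right)
  obtain B where B: "finite B" "B \<subseteq> T" "span B = T"
    using basis_subspace_exists[OF T] by metis
  define \<Phi> where "\<Phi> y = (\<Sum>i<m. F i y *\<^sub>R g i) + (\<Sum>b\<in>B. (b \<bullet> y) *\<^sub>R b)" for y
  define L where "L x h = (\<Sum>i<m. (G i x \<bullet> h) *\<^sub>R g i) + (\<Sum>b\<in>B. (b \<bullet> h) *\<^sub>R b)" for x h
  have blL: "bounded_linear (L x)" for x
    unfolding L_def by (intro bounded_linear_add bounded_linear_sum
        bounded_linear_compose[OF bounded_linear_scaleR_left bounded_linear_inner_right])
  define \<Phi>' where "\<Phi>' x = Blinfun (L x)" for x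
  have app: "blinfun_apply (\<Phi>' x) = L x" for x
    unfolding \<Phi>'_def by (rule bounded_linear_Blinfun_apply[OF blL])
  have der: "(\<Phi> has_derivative blinfun_apply (\<Phi>' x)) (at x)" if "x \<in> U" for x
    unfolding app unfolding \<Phi>_def L_def
  proof (intro has_derivative_add has_derivative_sum has_derivative_scaleR_left has_derivative_inner_right has_derivative_ident)
    fix i assume "i \<in> {..<m}"
    then show "(F i has_derivative (\<bullet>) (G i x)) (at x)"
      using F[of i x] that by (simp add: gderiv_def inner_commute[of _ "G i x"])
  qed
  have cont: "continuous_on U \<Phi>'"
  proof (rule continuous_on_blinfun_componentwise)
    fix i show "continuous_on U (\<lambda>x. blinfun_apply (\<Phi>' x) i)"
      unfolding app L_def using G by (auto intro!: continuous_intros)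
  qed
  have "inj (L xb)"
    unfolding linear_injective_0[OF bounded_linear.linear[OF blL]]
  proof (intro allI impI)
    fix h assume "L xb h = 0"
    then have "L xb h \<bullet> h = 0" by simp
    then have s: "(\<Sum>i<m. (g i \<bullet> h)\<^sup>2) + (\<Sum>b\<in>B. (b \<bullet> h)\<^sup>2) = 0"
      by (simp add: L_def g_def inner_add_left inner_sum_left power2_eq_square)
    then have "(\<Sum>i<m. (g i \<bullet> h)\<^sup>2) = 0" "(\<Sum>b\<in>B. (b \<bullet> h)\<^sup>2) = 0"
      using sum_nonneg[of "{..<m}" "\<lambda>i. (g i \<bullet> h)\<^sup>2"] sum_nonneg[of B "\<lambda>b. (b \<bullet> h)\<^sup>2"] by auto
    then have "h \<in> T" and Bh: "\<And>b. b \<in> B \<Longrightarrow> b \<bullet> h = 0"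
      using B(1) by (auto simp: sum_nonneg_eq_0_iff T_def)
    then have "h \<in> span B" using B by simp
    then have "h \<bullet> h = 0"
    proof (rule span_induct[where P = "\<lambda>y. y \<bullet> h = 0"])
      show "subspace {y. y \<bullet> h = 0}" by (auto simp: subspace_def inner_add_left)
    qed (use Bh in auto)
    then show "h = 0" by simp
  qed
  then obtain J where J: "linear J" "J \<circ> L xb = id"
    using linear_injective_left_inverse[OF bounded_linear.linear[OF blL]] by blast
  have J': "Blinfun J o\<^sub>L \<Phi>' xb = id_blinfun"
    by (rule blinfun_eqI)
      (use J in \<open>simp add: app bounded_linear_Blinfun_apply linear_conv_bounded_linear o_def fun_eq_iff\<close>)
  obtain U' V \<psi> \<psi>' where U': "open U'" "U' \<subseteq> U" "xb \<in> U'" and V: "open V" and "\<Phi> xb \<in> V"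
    and hom: "homeomorphism U' V \<Phi> \<psi>"
    and d\<psi>: "\<And>y. y \<in> V \<Longrightarrow> (\<psi> has_derivative (\<psi>' y)) (at y)"
    and \<psi>': "\<And>y. y \<in> V \<Longrightarrow> \<psi>' y = inv (blinfun_apply (\<Phi>' (\<psi> y)))"
    and bij: "\<And>y. y \<in> V \<Longrightarrow> bij (blinfun_apply (\<Phi>' (\<psi> y)))"
    by (rule inverse_function_theorem[OF U(1) der cont U(2) J']; (assumption | (rule that; assumption)))
  have "tangent_cone X x = {h. \<forall>i<m. G i x \<bullet> h = 0}" if x: "x \<in> X \<inter> U'" for x
  proof (intro equalityI subsetI CollectI allI impI)
    fix h i assume h: "h \<in> tangent_cone X x" and i: "i < m"
    have xU: "x \<in> U" "x \<in> X" using x U' by auto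
    have X0: "F i y = 0" if "y \<in> X \<inter> U" for y using that i unfolding X by simp
    have "F i y = F i x" if "y \<in> X \<inter> U" for y using X0[OF that] X0[of x] xU by simp
    then show "G i x \<bullet> h = 0" by (rule tangent_cone_level_set[OF h U(1) xU(1) _ F[OF i xU(1)]])
  next
    fix h assume "h \<in> {h. \<forall>i<m. G i x \<bullet> h = 0}"
    then have h: "\<And>i. i < m \<Longrightarrow> G i x \<bullet> h = 0" by blast
    have BT: "(\<Sum>b\<in>B. c b *\<^sub>R b) \<in> T" for c
      using B(2) by (intro subspace_sum[OF T] subspace_scale[OF T]) auto
    define k where "k = L x h"
    have kT: "k \<in> T" using BT h by (simp add: k_def L_def)
    have xV: "\<Phi> x \<in> V" "\<psi> (\<Phi> x) = x" using hom x unfolding homeomorphism_def by auto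
    have "x \<in> X \<inter> U" using x U' by blast
    then have "F i x = 0" if "i < m" for i using that unfolding X by simp
    then have \<Phi>T: "\<Phi> x \<in> T" using BT by (simp add: \<Phi>_def)
    \<comment> \<open>Near \<open>xb\<close> a point lies in \<open>X\<close> if its image under \<open>\<Phi>\<close> lies in \<open>T\<close>: the part of the image spanned by the \<open>g i\<close>
      is then both in \<open>T\<close> and orthogonal to \<open>T\<close>, and the \<open>g i\<close> are independent.\<close>
    have inX: "\<psi> (\<Phi> x + s *\<^sub>R k) \<in> X" if "\<Phi> x + s *\<^sub>R k \<in> V" for s
    proof -
      define y where "y = \<psi> (\<Phi> x + s *\<^sub>R k)"
      have y: "y \<in> U'" "\<Phi> y = \<Phi> x + s *\<^sub>R k" using hom that unfolding homeomorphism_def y_def by auto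
      define p where "p = (\<Sum>i<m. F i y *\<^sub>R g i)"
      have "p = (\<Phi> x + s *\<^sub>R k) - (\<Sum>b\<in>B. (b \<bullet> y) *\<^sub>R b)" using y(2) unfolding \<Phi>_def[of y] p_def[symmetric] by (simp only: eq_diff_eq)
      then have "p \<in> T"
        using \<Phi>T kT BT T by (auto intro!: subspace_diff subspace_add subspace_scale)
      then have "g i \<bullet> p = 0" if "i < m" for i using that by (simp add: T_def)
      moreover have "p \<bullet> p = (\<Sum>i<m. F i y * (g i \<bullet> p))" by (subst (1) p_def) (simp add: inner_sum_left)
      ultimately have "p \<bullet> p = 0" by simp
      then have "(\<Sum>i<m. F i y *\<^sub>R g i) = 0" by (simp add: p_def)
      then have "F i y = 0" if "i < m" for i
        using independent_family_sum_zero[of g m "\<lambda>i. F i y" i] dim that by (simp add: g_def[abs_def])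
      then have "y \<in> X \<inter> U" using y(1) U'(2) unfolding X by auto
      then show ?thesis by (simp add: y_def)
    qed
    \<comment> \<open>The curve in \<open>X\<close> that is a straight line in the chart has velocity \<open>h\<close> at \<open>x\<close>.\<close>
    have "\<psi>' (\<Phi> x) k = h"
      using bij[OF xV(1)] \<psi>'[OF xV(1)] by (simp add: xV(2) k_def app bij_is_inj)
    moreover have "((\<lambda>s. \<psi> (\<Phi> x + s *\<^sub>R k)) has_derivative (\<lambda>s. \<psi>' (\<Phi> x) (s *\<^sub>R k))) (at_right 0)"
      by (rule has_derivative_compose[where f = "\<lambda>s. \<Phi> x + s *\<^sub>R k" and g = \<psi>, OF _ d\<psi>[THEN has_derivative_eq_rhs]])
        (use xV(1) in \<open>auto intro!: derivative_eq_intros\<close>)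
    moreover have "\<psi>' (\<Phi> x) (s *\<^sub>R k) = s *\<^sub>R \<psi>' (\<Phi> x) k" for s
      using has_derivative_linear[OF d\<psi>[OF xV(1)]] by (simp add: linear_scale)
    ultimately have vd: "((\<lambda>s. \<psi> (\<Phi> x + s *\<^sub>R k)) has_vector_derivative h) (at_right 0)"
      by (simp add: has_vector_derivative_def)
    have "((\<lambda>s. \<Phi> x + s *\<^sub>R k) \<longlongrightarrow> \<Phi> x + 0 *\<^sub>R k) (at_right 0)" by (intro tendsto_intros)
    then have "\<forall>\<^sub>F s in at_right 0. \<Phi> x + s *\<^sub>R k \<in> V" using xV(1) by (auto dest: topological_tendstoD[OF _ V])
    then have "\<forall>\<^sub>F s in at_right 0. \<psi> (\<Phi> x + s *\<^sub>R k) \<in> X" by (rule eventually_mono) (rule inX)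
    then show "h \<in> tangent_cone X x"
      by (rule tangent_cone_curve[OF _ vd]) (use xV x in auto)
  qed
  then show thesis using that[OF U'(1,3)] continuous_on_subset[OF G U'(2)] by blast
qed

lemma subspace_orthogonal_family: "subspace {h. \<forall>i<m::nat. g i \<bullet> h = 0}"
  by (auto simp: subspace_def inner_add_right)

lemma proj_subspace_orthogonal:
  fixes T :: "'a::euclidean_space set"
  assumes T: "subspace T" and t: "t \<in> proj T a" and y: "y \<in> T"
  shows "(a - t) \<bullet> y = 0"
proof -
  have "(a - t) \<bullet> (z - t) \<le> 0" if "z \<in> T" for z
    by (rule any_closest_point_dot[OF subspace_imp_convex[OF T] closed_subspace[OF T] _ that])
      (use t in \<open>auto simp: proj_iff dist_norm norm_minus_commute\<close>)
  moreover have "t + y \<in> T" "t - y \<in> T"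
    using t y T by (auto simp: proj_iff intro: subspace_add subspace_diff)
  ultimately have "(a - t) \<bullet> (t + y - t) \<le> 0" "(a - t) \<bullet> (t - y - t) \<le> 0" by blast+
  then show ?thesis by simp
qed

text \<open>The segment between two points of \<open>C\<close> lies in \<open>C\<close>, hence its projection is a curve in \<open>X\<close>.\<close>

lemma convex_diff_in_tangent_cone:
  assumes C: "convex C" and sub: "fst ` C \<subseteq> X" and z: "(x, u) \<in> C" "(y, v) \<in> C"
  shows "y - x \<in> tangent_cone X x"
proof (rule tangent_cone_curve)
  show "\<forall>\<^sub>F s in at_right 0. x + s *\<^sub>R (y - x) \<in> X"
  proof (rule eventually_at_rightI[of 0 1])
    fix s :: real assume "s \<in> {0<..<1}"
    then have "(1 - s) *\<^sub>R (x, u) + s *\<^sub>R (y, v) \<in> C" by (intro convexD_alt[OF C z]) auto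
    then have "(1 - s) *\<^sub>R x + s *\<^sub>R y \<in> X" using sub by force
    then show "x + s *\<^sub>R (y - x) \<in> X" by (simp add: algebra_simps)
  qed simp
  show "((\<lambda>s. x + s *\<^sub>R (y - x)) has_vector_derivative y - x) (at_right 0)"
    by (auto intro!: derivative_eq_intros)
qed (use sub z in auto)

text \<open>Replacing the first component of a normal by its projection onto the tangent space changes it by a
vector orthogonal to that space, hence orthogonal to all displacements within \<open>C\<close>: the projected
vectors are again normals. Normality and tangency are both stable under limits, the latter because
the gradients that define the tangent spaces are continuous.\<close>

lemma outer_limit_projected_normal_cone_convex:
  fixes X :: "'a::euclidean_space set" and C :: "('a \<times> 'b::euclidean_space) set"
  assumes M: "smooth_manifold_around d X x" and C: "convex C" and sub: "fst ` C \<subseteq> X" and xu: "(x, u) \<in> C"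
  shows "(t, b) \<in> outer_limit (projected_normal_cone X C) C (x, u) \<longleftrightarrow>
     t \<in> tangent_cone X x \<and> (t, b) \<in> normal_cone C (x, u)"
proof
  assume "t \<in> tangent_cone X x \<and> (t, b) \<in> normal_cone C (x, u)"
  then have "(t, b) \<in> projected_normal_cone X C (x, u)"
    by (auto simp: projected_normal_cone_iff proj_iff intro!: exI[of _ t])
  then show "(t, b) \<in> outer_limit (projected_normal_cone X C) C (x, u)"
    using xu by (rule outer_limit_self[rotated])
next
  assume L: "(t, b) \<in> outer_limit (projected_normal_cone X C) C (x, u)"
  obtain U m G where U: "open U" "x \<in> U" and G: "\<And>i. i < m \<Longrightarrow> continuous_on U (G i)"
    and T: "\<And>x. x \<in> X \<inter> U \<Longrightarrow> tangent_cone X x = {h. \<forall>i<m::nat. G i x \<bullet> h = 0}"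
    by (rule tangent_cone_smooth_manifold[OF M]) (rule that; assumption)
  obtain zs vs where zs: "\<And>k::nat. zs k \<in> C" "zs \<longlonglongrightarrow> (x, u)"
      "\<And>k. vs k \<in> projected_normal_cone X C (zs k)" "vs \<longlonglongrightarrow> (t, b)"
    using L by (rule outer_limitE) blast
  have "eventually (\<lambda>k. fst (zs k) \<in> U) sequentially"
    using topological_tendstoD[OF tendsto_fst[OF zs(2)] U(1)] U(2) by simp
  then obtain N where N: "\<And>k. k \<ge> N \<Longrightarrow> fst (zs k) \<in> U" by (auto simp: eventually_sequentially)
  have in_normal: "vs k \<in> normal_cone C (zs k)" and in_tangent: "fst (vs k) \<in> tangent_cone X (fst (zs k))"
    if "k \<ge> N" for k
  proof -
    obtain y p s c where [simp]: "zs k = (y, p)" "vs k = (s, c)" by (metis surj_pair)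
    obtain a where a: "(a, c) \<in> normal_cone C (y, p)" "s \<in> proj (tangent_cone X y) a"
      using zs(3)[of k] by (auto simp: projected_normal_cone_iff)
    have yC: "(y, p) \<in> C" using zs(1)[of k] by simp
    then have "y \<in> X \<inter> U" using N[OF that] sub by force
    then have sp: "subspace (tangent_cone X y)" by (simp only: T subspace_orthogonal_family)
    have "(s, c) \<bullet> (z - (y, p)) \<le> 0" if "z \<in> C" for z
    proof -
      obtain y' p' where [simp]: "z = (y', p')" by (cases z)
      have "(a - s) \<bullet> (y' - y) = 0"
        using convex_diff_in_tangent_cone[OF C sub yC] that
        by (intro proj_subspace_orthogonal[OF sp a(2)]) simp
      then have "(s, c) \<bullet> (z - (y, p)) = (a, c) \<bullet> (z - (y, p))" by (simp add: inner_diff_left)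
      also have "\<dots> \<le> 0" using a(1) that unfolding normal_cone_convex_iff[OF C] by blast
      finally show ?thesis .
    qed
    then show "vs k \<in> normal_cone C (zs k)" using yC unfolding normal_cone_convex_iff[OF C] by auto
    show "fst (vs k) \<in> tangent_cone X (fst (zs k))" using a(2) by (simp add: proj_iff)
  qed
  have lim: "(\<lambda>k. zs (k + N)) \<longlonglongrightarrow> (x, u)" "(\<lambda>k. vs (k + N)) \<longlonglongrightarrow> (t, b)"
    using LIMSEQ_ignore_initial_segment zs(2,4) by blast+
  have "(t, b) \<in> outer_limit (normal_cone C) C (x, u)"
    by (rule outer_limitI[OF _ lim(1) _ lim(2)]) (use zs(1) in_normal in auto)
  then have n: "(t, b) \<in> normal_cone C (x, u)" by (rule normal_cone_outer_limit_subset[OF xu])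
  have xX: "x \<in> X" using xu sub by force
  have "G i x \<bullet> t = 0" if i: "i < m" for i
  proof -
    have "(\<lambda>k. G i (fst (zs (k + N)))) \<longlonglongrightarrow> G i x"
      using continuous_on_tendsto_compose[OF G[OF i] tendsto_fst[OF lim(1)]] U(2) N by simp
    then have 1: "(\<lambda>k. G i (fst (zs (k + N))) \<bullet> fst (vs (k + N))) \<longlonglongrightarrow> G i x \<bullet> t"
      using tendsto_fst[OF lim(2)] by (auto intro: tendsto_inner)
    have "fst (zs (k + N)) \<in> X \<inter> U" for k using N zs(1)[of "k + N"] sub by auto
    then have "G i (fst (zs (k + N))) \<bullet> fst (vs (k + N)) = 0" for k
      using in_tangent[of "k + N"] T i by auto
    then show ?thesis using 1 by (simp add: LIMSEQ_const_iff)
  qed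
  then have "t \<in> tangent_cone X x" using T[of x] xX U(2) by auto
  then show "t \<in> tangent_cone X x \<and> (t, b) \<in> normal_cone C (x, u)" using n by blast
qed

lemma normal_cone_relcomp_convex:
  assumes C: "convex C1" "convex C2" "convex (C1 O C2)"
    and w: "(x, w) \<in> C1" "(w, u) \<in> C2"
    and n: "(t, - q) \<in> normal_cone C1 (x, w)" "(q, b) \<in> normal_cone C2 (w, u)"
  shows "(t, b) \<in> normal_cone (C1 O C2) (x, u)"
  unfolding normal_cone_convex_iff[OF C(3)]
proof (intro conjI ballI)
  show "(x, u) \<in> C1 O C2" using w by blast
  fix z assume "z \<in> C1 O C2"
  then obtain x' w' u' where z: "z = (x', u')" "(x', w') \<in> C1" "(w', u') \<in> C2" by blast
  have "(t, - q) \<bullet> ((x', w') - (x, w)) \<le> 0" "(q, b) \<bullet> ((w', u') - (w, u)) \<le> 0"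
    using n z unfolding normal_cone_convex_iff[OF C(1)] normal_cone_convex_iff[OF C(2)] by blast+
  then show "(t, b) \<bullet> (z - (x, u)) \<le> 0" by (simp add: z)
qed

text \<open>The normal inequality for \<open>C1\<close> at \<open>(x, w)\<close>, tested at \<open>(x, w')\<close>, gives \<open>q \<bullet> w' \<ge> q \<bullet> w\<close>; the one for \<open>C2\<close>, tested
at \<open>(w', u)\<close>, gives the opposite. So \<open>q\<close> takes the same value at \<open>w\<close> and \<open>w'\<close>, and the inequalities do not
notice the exchange.\<close>

lemma convex_multiplier_fibre_independent:
  assumes C: "convex C1" "convex C2"
    and n: "(t, - q) \<in> normal_cone C1 (x, w)" "(q, b) \<in> normal_cone C2 (w, u)"
    and w': "(x, w') \<in> C1" "(w', u) \<in> C2"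
  shows "(t, - q) \<in> normal_cone C1 (x, w')" "(q, b) \<in> normal_cone C2 (w', u)"
proof -
  have 1: "\<And>y p. (y, p) \<in> C1 \<Longrightarrow> t \<bullet> (y - x) - q \<bullet> (p - w) \<le> 0"
    using n(1) unfolding normal_cone_convex_iff[OF C(1)] by fastforce
  have 2: "\<And>p v. (p, v) \<in> C2 \<Longrightarrow> q \<bullet> (p - w) + b \<bullet> (v - u) \<le> 0"
    using n(2) unfolding normal_cone_convex_iff[OF C(2)] by fastforce
  have qw: "q \<bullet> w' = q \<bullet> w" using 1[OF w'(1)] 2[OF w'(2)] by (simp add: inner_diff_right)
  have "(t, - q) \<bullet> (z - (x, w')) \<le> 0" if "z \<in> C1" for z
    using 1[of "fst z" "snd z"] that qw by (cases z) (simp add: inner_diff_right)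
  then show "(t, - q) \<in> normal_cone C1 (x, w')"
    using w'(1) unfolding normal_cone_convex_iff[OF C(1)] by blast
  have "(q, b) \<bullet> (z - (w', u)) \<le> 0" if "z \<in> C2" for z
    using 2[of "fst z" "snd z"] that qw by (cases z) (simp add: inner_diff_right)
  then show "(q, b) \<in> normal_cone C2 (w', u)"
    using w'(2) unfolding normal_cone_convex_iff[OF C(2)] by blast
qed

section \<open>Outer semicontinuity of compositions\<close>

lemma gph_sv_comp: "gph (sv_comp A B) = gph B O gph A"
  by (auto simp: gph_def sv_comp_def)

lemma sv_restrict_sv_comp: "sv_restrict (sv_comp A B) X = sv_comp A (sv_restrict B X)"
  by (auto simp: sv_restrict_def sv_comp_def fun_eq_iff)

lemma closed_gph_sv_restrict:
  fixes S :: "'a::metric_space \<Rightarrow> 'b::metric_space set"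
  assumes X: "closed X" and S: "osc_rel S X"
  shows "closed (gph (sv_restrict S X))"
  unfolding closed_sequential_limits
proof (intro allI impI, elim conjE)
  fix zs z assume zs: "\<forall>k. zs k \<in> gph (sv_restrict S X)" "zs \<longlonglongrightarrow> z"
  have k: "fst (zs k) \<in> X" "snd (zs k) \<in> S (fst (zs k))" for k
    using zs(1)[rule_format, of k] by (auto simp: gph_def sv_restrict_def case_prod_unfold split: if_splits)
  have x: "fst z \<in> X" by (rule closed_sequentially[OF X k(1) tendsto_fst[OF zs(2)]])
  have "snd z \<in> outer_limit S X (fst z)"
    by (rule outer_limitI[OF k(1) tendsto_fst[OF zs(2)] k(2) tendsto_snd[OF zs(2)]])
  then have "snd z \<in> S (fst z)" using S x by (auto simp: osc_rel_def osc_at_rel_def)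
  then show "z \<in> gph (sv_restrict S X)" using x by (simp add: gph_def sv_restrict_def case_prod_unfold)
qed

lemma closed_gph_osc:
  fixes S :: "'a::metric_space \<Rightarrow> 'b::metric_space set"
  assumes "osc S"
  shows "closed (gph S)"
proof -
  have "sv_restrict S UNIV = S" by (simp add: sv_restrict_def fun_eq_iff)
  then show ?thesis using closed_gph_sv_restrict[of UNIV S] assms by (simp add: osc_def)
qed

text \<open>The local boundedness hypothesis in the form used for compositions of graphs.\<close>

lemma locally_bounded_intermediateE:
  fixes A :: "'a::metric_space \<Rightarrow> 'b::metric_space set" and B :: "'b \<Rightarrow> 'c::metric_space set"
  assumes "locally_bounded (\<lambda>(x, u). A x \<inter> sv_inverse B u) z"
  obtains Q where "open Q" "z \<in> Q" "bounded {w. \<exists>(x, u)\<in>Q. (x, w) \<in> gph A \<and> (w, u) \<in> gph B}"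
proof -
  obtain V where V: "z \<in> interior V" "bounded (\<Union>(x, u)\<in>V. A x \<inter> sv_inverse B u)"
    using assms by (auto simp: locally_bounded_def locally_bounded_rel_def)
  have "{w. \<exists>(x, u)\<in>interior V. (x, w) \<in> gph A \<and> (w, u) \<in> gph B} \<subseteq> (\<Union>(x, u)\<in>V. A x \<inter> sv_inverse B u)"
    using interior_subset[of V] by (force simp: gph_def sv_inverse_def)
  then show thesis using that[OF open_interior V(1)] bounded_subset[OF V(2)] by blast
qed

lemma closed_relcomp_near:
  fixes C1 :: "('a::metric_space \<times> 'b::heine_borel) set" and C2 :: "('b \<times> 'c::metric_space) set"
  assumes cl: "closed C1" "closed C2" and Q: "open Q" "z \<in> Q"
    and bd: "bounded {w. \<exists>(x, u)\<in>Q. (x, w) \<in> C1 \<and> (w, u) \<in> C2}"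
  obtains r where "r > 0" "closed ((C1 O C2) \<inter> cball z r)"
proof -
  obtain r where r: "r > 0" "cball z r \<subseteq> Q" using Q open_contains_cball by blast
  have "closed ((C1 O C2) \<inter> cball z r)"
    by (rule closed_relcomp_Int[OF cl closed_cball], rule bounded_subset[OF bd]) (use r in blast)
  then show thesis using that r by blast
qed

lemma centre_in_interior_cball: "r > 0 \<Longrightarrow> x \<in> interior (cball x r)"
  using interior_maximal[OF ball_subset_cball open_ball, of x r] by auto

lemma osc_sv_comp:
  fixes A :: "'b::heine_borel \<Rightarrow> 'c::metric_space set" and B :: "'a::metric_space \<Rightarrow> 'b set"
  assumes cl: "closed (gph B)" "closed (gph A)"
    and lb: "\<And>x u. locally_bounded (\<lambda>(x, u). B x \<inter> sv_inverse A u) (x, u)"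
  shows "osc (sv_comp A B)"
  unfolding osc_def osc_rel_def osc_at_rel_def
proof (intro ballI conjI equalityI subsetI)
  fix x u assume "u \<in> sv_comp A B x"
  then show "u \<in> outer_limit (sv_comp A B) UNIV x" by (rule outer_limit_self[OF UNIV_I])
next
  fix x u assume "u \<in> outer_limit (sv_comp A B) UNIV x"
  then obtain xs us where seq: "xs \<longlonglongrightarrow> x" "\<And>k::nat. us k \<in> sv_comp A B (xs k)" "us \<longlonglongrightarrow> u"
    by (rule outer_limitE) blast
  obtain Q where Q: "open Q" "(x, u) \<in> Q" "bounded {w. \<exists>(x, u)\<in>Q. (x, w) \<in> gph B \<and> (w, u) \<in> gph A}"
    using lb by (rule locally_bounded_intermediateE)
  obtain r where r: "r > 0" "closed ((gph B O gph A) \<inter> cball (x, u) r)"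
    by (rule closed_relcomp_near[OF cl Q])
  have lim: "(\<lambda>k. (xs k, us k)) \<longlonglongrightarrow> (x, u)" by (intro tendsto_intros seq)
  obtain N where N: "\<And>k. k \<ge> N \<Longrightarrow> dist (xs k, us k) (x, u) < r"
    using tendstoD[OF lim r(1)] by (auto simp: eventually_sequentially)
  have "(xs (k + N), us (k + N)) \<in> (gph B O gph A) \<inter> cball (x, u) r" for k
    using N[of "k + N"] seq(2)[of "k + N"] gph_sv_comp[of A B] by (auto simp: gph_def dist_commute)
  then have "(x, u) \<in> gph B O gph A"
    using closed_sequentially[OF r(2) _ LIMSEQ_ignore_initial_segment[OF lim, of N]] by blast
  then show "u \<in> sv_comp A B x" unfolding gph_sv_comp[symmetric] by (simp add: gph_def)
qed simp

lemma osc_rel_sv_comp_local: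
  fixes A :: "'b::heine_borel \<Rightarrow> 'c::heine_borel set" and B :: "'a::heine_borel \<Rightarrow> 'b set"
  assumes cl: "closed (gph B)" "closed (gph A)"
    and lb: "locally_bounded (\<lambda>(x, u). B x \<inter> sv_inverse A u) (xb, ub)"
  shows "\<exists>V W. closed V \<and> xb \<in> interior V \<and> closed W \<and> ub \<in> interior W \<and>
           osc_rel (\<lambda>x. sv_comp A B x \<inter> W) V"
proof -
  obtain Q where Q: "open Q" "(xb, ub) \<in> Q"
      and bd: "bounded {w. \<exists>(x, u)\<in>Q. (x, w) \<in> gph B \<and> (w, u) \<in> gph A}"
    using lb by (rule locally_bounded_intermediateE)
  obtain V0 W0 where o: "open V0" "open W0" "(xb, ub) \<in> V0 \<times> W0" "V0 \<times> W0 \<subseteq> Q"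
    using open_prod_elim[OF Q] by metis
  obtain r1 r2 where r: "r1 > 0" "cball xb r1 \<subseteq> V0" "r2 > 0" "cball ub r2 \<subseteq> W0"
    using o by (metis mem_Sigma_iff open_contains_cball)
  define V W where "V = cball xb r1" and "W = cball ub r2"
  have "V \<times> W \<subseteq> Q" using Sigma_mono[OF r(2) r(4)] o(4) by (simp add: V_def W_def)
  then have closed: "closed ((gph B O gph A) \<inter> V \<times> W)"
    by (intro closed_relcomp_Int[OF cl] bounded_subset[OF bd])
      (auto simp: V_def W_def closed_Times)
  have "osc_rel (\<lambda>x. sv_comp A B x \<inter> W) V"
    unfolding osc_rel_def osc_at_rel_def
  proof (intro ballI conjI equalityI subsetI)
    fix x u assume "x \<in> V" "u \<in> sv_comp A B x \<inter> W"
    then show "u \<in> outer_limit (\<lambda>x. sv_comp A B x \<inter> W) V x" by (rule outer_limit_self)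
  next
    fix x u assume "u \<in> outer_limit (\<lambda>x. sv_comp A B x \<inter> W) V x"
    then obtain xs us where seq: "\<And>k::nat. xs k \<in> V" "xs \<longlonglongrightarrow> x" "\<And>k::nat. us k \<in> sv_comp A B (xs k) \<inter> W" "us \<longlonglongrightarrow> u"
      by (rule outer_limitE) blast
    have "(xs k, us k) \<in> (gph B O gph A) \<inter> V \<times> W" for k
      using seq(1,3)[of k] unfolding gph_sv_comp[symmetric] by (simp add: gph_def)
    moreover have "(\<lambda>k. (xs k, us k)) \<longlonglongrightarrow> (x, u)" by (intro tendsto_intros seq)
    ultimately have "(x, u) \<in> (gph B O gph A) \<inter> V \<times> W" by (rule closed_sequentially[OF closed])
    then show "u \<in> sv_comp A B x \<inter> W" unfolding gph_sv_comp[symmetric] by (simp add: gph_def)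
  qed simp
  then show ?thesis
    using r by (intro exI[of _ V] exI[of _ W]) (auto simp: V_def W_def centre_in_interior_cball)
qed

section \<open>The projectional coderivative of a composition\<close>

lemma proj_coderiv_iff:
  "t \<in> proj_coderiv X S x u v \<longleftrightarrow>
     (t, - v) \<in> outer_limit (projected_normal_cone X (gph (sv_restrict S X))) (gph (sv_restrict S X)) (x, u)"
proof -
  have "(\<lambda>(x, u). proj_set (tangent_cone X x \<times> UNIV) (normal_cone (gph (sv_restrict S X)) (x, u)))
      = projected_normal_cone X (gph (sv_restrict S X))"
    by (auto simp: projected_normal_cone_def)
  then show ?thesis by (simp add: proj_coderiv_def)
qed

lemma coderiv_iff: "t \<in> coderiv S x u v \<longleftrightarrow> (t, - v) \<in> normal_cone (gph S) (x, u)"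
  by (simp add: coderiv_def)

lemma convex_relcomp:
  fixes C1 :: "('a::real_vector \<times> 'b::real_vector) set" and C2 :: "('b \<times> 'c::real_vector) set"
  assumes "convex C1" "convex C2"
  shows "convex (C1 O C2)"
proof (rule convexI)
  fix p q and s t :: real assume "p \<in> C1 O C2" "q \<in> C1 O C2" and st: "0 \<le> s" "0 \<le> t" "s + t = 1"
  then obtain x w u x' w' u' where *: "p = (x, u)" "(x, w) \<in> C1" "(w, u) \<in> C2"
      "q = (x', u')" "(x', w') \<in> C1" "(w', u') \<in> C2" by blast
  have "(s *\<^sub>R x + t *\<^sub>R x', s *\<^sub>R w + t *\<^sub>R w') \<in> C1" "(s *\<^sub>R w + t *\<^sub>R w', s *\<^sub>R u + t *\<^sub>R u') \<in> C2"
    using convexD[OF assms(1) *(2,5) st] convexD[OF assms(2) *(3,6) st] by simp_all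
  then show "s *\<^sub>R p + t *\<^sub>R q \<in> C1 O C2" using * by auto
qed

lemma lipschitz_like_imp_qualification:
  fixes S1 :: "'a::euclidean_space \<Rightarrow> 'b::euclidean_space set" and S2 :: "'b \<Rightarrow> 'c::euclidean_space set"
  assumes "w \<in> sv_restrict S1 X x \<inter> sv_inverse S2 u" "lipschitz_like S2 w u"
  shows "coderiv S2 w u 0 \<inter> sv_inverse (proj_coderiv X S1 x w) 0 = {0}"
proof -
  have w: "(x, w) \<in> gph (sv_restrict S1 X)" "(w, u) \<in> gph S2" "x \<in> X"
    using assms(1) by (auto simp: gph_def sv_inverse_def sv_restrict_def split: if_splits)
  have "q = 0" if "q \<in> coderiv S2 w u 0" for q
    using lipschitz_like_imp_normal_zero[OF assms(2)] that by (simp add: coderiv_iff)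
  moreover have "0 \<in> coderiv S2 w u 0"
    using zero_in_normal_cone[OF w(2)] by (simp add: coderiv_iff zero_prod_def)
  moreover have "(0, 0) \<in> projected_normal_cone X (gph (sv_restrict S1 X)) (x, w)"
    using zero_in_normal_cone[OF w(1)] zero_in_tangent_cone[OF w(3)]
    by (auto simp: projected_normal_cone_iff zero_prod_def proj_iff intro!: exI[of _ 0])
  then have "0 \<in> proj_coderiv X S1 x w 0"
    using w(1) by (simp add: proj_coderiv_iff outer_limit_self)
  ultimately show ?thesis by (auto simp: sv_inverse_def)
qed

text \<open>The multiplier \<open>l\<close> of the projected rule is positive: if it were \<open>0\<close>, then \<open>q\<close> would be a unit vector that
the qualification condition \<open>cq\<close> forbids. Dividing by \<open>l\<close> turns the rule into the chain rule.\<close>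

lemma proj_coderiv_sv_comp_subset:
  fixes S1 :: "'a::euclidean_space \<Rightarrow> 'b::euclidean_space set" and S2 :: "'b \<Rightarrow> 'c::euclidean_space set"
  assumes cl: "closed (gph (sv_restrict S1 X))" "closed (gph S2)"
    and lb: "locally_bounded (\<lambda>(x, u). sv_restrict S1 X x \<inter> sv_inverse S2 u) (x, u)"
    and cq: "\<And>w. w \<in> sv_restrict S1 X x \<inter> sv_inverse S2 u \<Longrightarrow>
        coderiv S2 w u 0 \<inter> sv_inverse (proj_coderiv X S1 x w) 0 = {0}"
    and t: "t \<in> proj_coderiv X (sv_comp S2 S1) x u v"
  shows "\<exists>w q. w \<in> sv_restrict S1 X x \<inter> sv_inverse S2 u \<and>
     t \<in> proj_coderiv X S1 x w q \<and> q \<in> coderiv S2 w u v"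
proof -
  let ?C1 = "gph (sv_restrict S1 X)" and ?C2 = "gph S2"
  obtain Q where Q: "open Q" "(x, u) \<in> Q" "bounded {w. \<exists>(x, u)\<in>Q. (x, w) \<in> ?C1 \<and> (w, u) \<in> ?C2}"
    using lb by (rule locally_bounded_intermediateE)
  have "(t, - v) \<in> outer_limit (projected_normal_cone X (?C1 O ?C2)) (?C1 O ?C2) (x, u)"
    using t by (simp add: proj_coderiv_iff sv_restrict_sv_comp gph_sv_comp)
  from projected_normal_relcomp_multiplier[OF cl Q this]
  obtain w l q where l: "l \<ge> 0" "l + norm q = 1"
    and n: "(l *\<^sub>R t, - q) \<in> outer_limit (projected_normal_cone X ?C1) ?C1 (x, w)"
      "(q, l *\<^sub>R - v) \<in> normal_cone ?C2 (w, u)" by blast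
  have "(x, w) \<in> ?C1" by (rule outer_limit_imp_mem_closed[OF n(1) cl(1)])
  moreover have "(w, u) \<in> ?C2" using n(2) by (auto simp: normal_cone_def split: if_splits)
  ultimately have w: "w \<in> sv_restrict S1 X x \<inter> sv_inverse S2 u" by (simp add: gph_def sv_inverse_def)
  have "l \<noteq> 0"
  proof
    assume "l = 0"
    then have "q \<in> coderiv S2 w u 0" "q \<in> sv_inverse (proj_coderiv X S1 x w) 0"
      using n by (simp_all add: coderiv_iff sv_inverse_def proj_coderiv_iff)
    then have "q = 0" using cq[OF w] by blast
    then show False using l \<open>l = 0\<close> by simp
  qed
  then have l: "l > 0" using l by simp
  have "(1 / l) *\<^sub>R (l *\<^sub>R t, - q) \<in> outer_limit (projected_normal_cone X ?C1) ?C1 (x, w)"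
    by (rule outer_limit_scale[OF n(1)], rule projected_normal_cone_scale) (use l in auto)
  then have "t \<in> proj_coderiv X S1 x w ((1 / l) *\<^sub>R q)" using l by (simp add: proj_coderiv_iff)
  moreover have "(1 / l) *\<^sub>R q \<in> coderiv S2 w u v"
    using normal_cone_scale[OF n(2), of "1 / l"] l by (simp add: coderiv_iff)
  ultimately show ?thesis using w by blast
qed

text \<open>One inclusion is the general one followed by a change of the intermediate point, the other the
sum of two normal inequalities. Tangency of \<open>t\<close> to \<open>X\<close> is the same condition on both sides.\<close>

lemma proj_coderiv_sv_comp_convex:
  fixes S1 :: "'a::euclidean_space \<Rightarrow> 'b::euclidean_space set" and S2 :: "'b \<Rightarrow> 'c::euclidean_space set"
  assumes cl: "closed (gph (sv_restrict S1 X))" "closed (gph S2)"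
    and lb: "locally_bounded (\<lambda>(x, u). sv_restrict S1 X x \<inter> sv_inverse S2 u) (x, u)"
    and cq: "\<And>w. w \<in> sv_restrict S1 X x \<inter> sv_inverse S2 u \<Longrightarrow>
        coderiv S2 w u 0 \<inter> sv_inverse (proj_coderiv X S1 x w) 0 = {0}"
    and cv: "graph_convex (sv_restrict S1 X)" "graph_convex S2" and M: "smooth_manifold_around d X x"
    and w: "w \<in> sv_restrict S1 X x \<inter> sv_inverse S2 u"
  shows "proj_coderiv X (sv_comp S2 S1) x u v = sv_comp (proj_coderiv X S1 x w) (coderiv S2 w u) v"
proof -
  let ?C1 = "gph (sv_restrict S1 X)" and ?C2 = "gph S2"
  have C: "convex ?C1" "convex ?C2" using cv by (simp_all add: graph_convex_def)
  have C': "convex (?C1 O ?C2)" by (rule convex_relcomp[OF C])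
  have mem: "(x, w) \<in> ?C1" "(w, u) \<in> ?C2" if "w \<in> sv_restrict S1 X x \<inter> sv_inverse S2 u" for w
    using that by (simp_all add: gph_def sv_inverse_def)
  have sub1: "fst ` ?C1 \<subseteq> X" by (auto simp: gph_def sv_restrict_def split: if_splits)
  have sub: "fst ` (?C1 O ?C2) \<subseteq> X" using sub1 by force
  have pc1: "t \<in> proj_coderiv X S1 x w q \<longleftrightarrow> t \<in> tangent_cone X x \<and> (t, - q) \<in> normal_cone ?C1 (x, w)"
    if "w \<in> sv_restrict S1 X x \<inter> sv_inverse S2 u" for t w q
    unfolding proj_coderiv_iff
    by (rule outer_limit_projected_normal_cone_convex[OF M C(1) sub1 mem(1)[OF that]])
  have xu: "(x, u) \<in> ?C1 O ?C2" using mem[OF w] by blast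
  have pc: "t \<in> proj_coderiv X (sv_comp S2 S1) x u v \<longleftrightarrow>
      t \<in> tangent_cone X x \<and> (t, - v) \<in> normal_cone (?C1 O ?C2) (x, u)" for t
    unfolding proj_coderiv_iff sv_restrict_sv_comp gph_sv_comp
    by (rule outer_limit_projected_normal_cone_convex[OF M C' sub xu])
  show ?thesis
  proof (intro equalityI subsetI)
    fix t assume t: "t \<in> proj_coderiv X (sv_comp S2 S1) x u v"
    obtain w' q where w': "w' \<in> sv_restrict S1 X x \<inter> sv_inverse S2 u"
      and q: "t \<in> proj_coderiv X S1 x w' q" "q \<in> coderiv S2 w' u v"
      using proj_coderiv_sv_comp_subset[OF cl lb cq t] by blast
    have "(t, - q) \<in> normal_cone ?C1 (x, w')" "(q, - v) \<in> normal_cone ?C2 (w', u)" "t \<in> tangent_cone X x"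
      using q pc1[OF w'] by (simp_all add: coderiv_iff)
    then have "t \<in> proj_coderiv X S1 x w q" "q \<in> coderiv S2 w u v"
      using convex_multiplier_fibre_independent[OF C _ _ mem[OF w]] pc1[OF w] by (auto simp: coderiv_iff)
    then show "t \<in> sv_comp (proj_coderiv X S1 x w) (coderiv S2 w u) v" by (auto simp: sv_comp_def)
  next
    fix t assume "t \<in> sv_comp (proj_coderiv X S1 x w) (coderiv S2 w u) v"
    then obtain q where q: "q \<in> coderiv S2 w u v" "t \<in> proj_coderiv X S1 x w q" by (auto simp: sv_comp_def)
    then show "t \<in> proj_coderiv X (sv_comp S2 S1) x u v"
      using normal_cone_relcomp_convex[OF C C' mem[OF w]] pc1[OF w] by (auto simp: pc coderiv_iff)
  qed
qed

theorem theorem5p1: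
  fixes S :: "real^'n \<Rightarrow> (real^'m) set"
    and S1 :: "real^'n \<Rightarrow> (real^'p) set"
    and S2 :: "real^'p \<Rightarrow> (real^'m) set"
    and X :: "(real^'n) set"
    and xb :: "real^'n" and ub :: "real^'m"
  assumes "S = sv_comp S2 S1"
    and "closed X" and "xb \<in> X"
    and "osc_rel S1 X" and "osc S2"
    and "(xb, ub) \<in> gph (sv_restrict S X)"
  shows
    "gph (sv_restrict S X) = gph (sv_comp S2 (sv_restrict S1 X)) \<and>
     (locally_bounded (\<lambda>(x, u). sv_restrict S1 X x \<inter> sv_inverse S2 u) (xb, ub) \<longleftrightarrow>
      locally_bounded_rel (\<lambda>(x, u). S1 x \<inter> sv_inverse S2 u) (X \<times> UNIV) (xb, ub)) \<and>
     (locally_bounded_rel S1 X xb \<or> locally_bounded (sv_inverse S2) ub \<longrightarrow>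
      locally_bounded (\<lambda>(x, u). sv_restrict S1 X x \<inter> sv_inverse S2 u) (xb, ub)) \<and>
     ((\<forall>x u. locally_bounded (\<lambda>(x, u). sv_restrict S1 X x \<inter> sv_inverse S2 u) (x, u)) \<longrightarrow>
      osc (sv_comp S2 (sv_restrict S1 X))) \<and>
     (\<forall>wb \<in> sv_restrict S1 X xb \<inter> sv_inverse S2 ub.
        lipschitz_like S2 wb ub \<longrightarrow>
        coderiv S2 wb ub 0 \<inter> sv_inverse (proj_coderiv X S1 xb wb) 0 = {0}) \<and>
     (locally_bounded (\<lambda>(x, u). sv_restrict S1 X x \<inter> sv_inverse S2 u) (xb, ub) \<longrightarrow>
        (\<exists>V W. closed V \<and> xb \<in> interior V \<and> closed W \<and> ub \<in> interior W \<and>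
           osc_rel (\<lambda>x. sv_comp S2 (sv_restrict S1 X) x \<inter> W) V) \<and>
        ((\<forall>wb \<in> sv_restrict S1 X xb \<inter> sv_inverse S2 ub.
            coderiv S2 wb ub 0 \<inter> sv_inverse (proj_coderiv X S1 xb wb) 0 = {0}) \<longrightarrow>
           locally_closed_at (gph (sv_restrict S X)) (xb, ub) \<and>
           (\<forall>us. proj_coderiv X S xb ub us \<subseteq>
              (\<Union>wb \<in> sv_restrict S1 X xb \<inter> sv_inverse S2 ub.
                 sv_comp (proj_coderiv X S1 xb wb) (coderiv S2 wb ub) us)) \<and>
           (graph_convex (sv_restrict S1 X) \<and> graph_convex S2 \<and>
            (\<exists>d. smooth_manifold_around d X xb) \<longrightarrow>
              graph_convex (sv_restrict S X) \<and>
              (\<forall>wb \<in> sv_restrict S1 X xb \<inter> sv_inverse S2 ub.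
                 proj_coderiv X S xb ub =
                 sv_comp (proj_coderiv X S1 xb wb) (coderiv S2 wb ub)))))"
proof -
  let ?C1 = "gph (sv_restrict S1 X)" and ?C2 = "gph S2"
  let ?fib = "sv_restrict S1 X xb \<inter> sv_inverse S2 ub"
  let ?lb = "locally_bounded (\<lambda>(x, u). sv_restrict S1 X x \<inter> sv_inverse S2 u)"
  let ?cq = "\<forall>wb\<in>?fib. coderiv S2 wb ub 0 \<inter> sv_inverse (proj_coderiv X S1 xb wb) 0 = {0}"
  have cl: "closed ?C1" "closed ?C2"
    using assms(2,4,5) by (simp_all add: closed_gph_sv_restrict closed_gph_osc)
  have gph: "gph (sv_restrict S X) = ?C1 O ?C2"
    by (simp add: assms(1) sv_restrict_sv_comp gph_sv_comp)
  have "gph (sv_restrict S X) = gph (sv_comp S2 (sv_restrict S1 X))"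
    by (simp add: assms(1) sv_restrict_sv_comp)
  moreover have "?lb (xb, ub) \<longleftrightarrow>
      locally_bounded_rel (\<lambda>(x, u). S1 x \<inter> sv_inverse S2 u) (X \<times> UNIV) (xb, ub)"
  proof -
    have "(\<Union>y\<in>V. case y of (x, u) \<Rightarrow> sv_restrict S1 X x \<inter> sv_inverse S2 u)
        = (\<Union>y\<in>V \<inter> (X \<times> UNIV). case y of (x, u) \<Rightarrow> S1 x \<inter> sv_inverse S2 u)" for V
      by (auto simp: sv_restrict_def split: if_splits)
    then show ?thesis using assms(3) by (simp add: locally_bounded_def locally_bounded_rel_def)
  qed
  moreover have "?lb (xb, ub)" if "locally_bounded_rel S1 X xb \<or> locally_bounded (sv_inverse S2) ub"
    using that
  proof
    assume "locally_bounded_rel S1 X xb"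
    then obtain V where V: "xb \<in> interior V" "bounded (\<Union>y\<in>V \<inter> X. S1 y)"
      by (auto simp: locally_bounded_rel_def)
    have "bounded (\<Union>(x, u)\<in>V \<times> UNIV. sv_restrict S1 X x \<inter> sv_inverse S2 u)"
      by (rule bounded_subset[OF V(2)]) (auto simp: sv_restrict_def split: if_splits)
    then show ?thesis using V(1)
      by (auto simp: locally_bounded_def locally_bounded_rel_def interior_Times intro!: exI[of _ "V \<times> UNIV"])
  next
    assume "locally_bounded (sv_inverse S2) ub"
    then obtain V where V: "ub \<in> interior V" "bounded (\<Union>u\<in>V. sv_inverse S2 u)"
      by (auto simp: locally_bounded_def locally_bounded_rel_def)
    have "bounded (\<Union>(x, u)\<in>UNIV \<times> V. sv_restrict S1 X x \<inter> sv_inverse S2 u)"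
      by (rule bounded_subset[OF V(2)]) auto
    then show ?thesis using V(1)
      by (auto simp: locally_bounded_def locally_bounded_rel_def interior_Times intro!: exI[of _ "UNIV \<times> V"])
  qed
  moreover have "osc (sv_comp S2 (sv_restrict S1 X))" if "\<forall>x u. ?lb (x, u)"
    using osc_sv_comp[OF cl] that by blast
  moreover have "coderiv S2 wb ub 0 \<inter> sv_inverse (proj_coderiv X S1 xb wb) 0 = {0}"
    if "wb \<in> ?fib" "lipschitz_like S2 wb ub" for wb
    by (rule lipschitz_like_imp_qualification[OF that])
  moreover have "\<exists>V W. closed V \<and> xb \<in> interior V \<and> closed W \<and> ub \<in> interior W \<and>
      osc_rel (\<lambda>x. sv_comp S2 (sv_restrict S1 X) x \<inter> W) V" if "?lb (xb, ub)"
    by (rule osc_rel_sv_comp_local[OF cl that])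
  moreover have "locally_closed_at (gph (sv_restrict S X)) (xb, ub)" if lb: "?lb (xb, ub)"
  proof -
    obtain Q where Q: "open Q" "(xb, ub) \<in> Q" "bounded {w. \<exists>(x, u)\<in>Q. (x, w) \<in> ?C1 \<and> (w, u) \<in> ?C2}"
      using lb by (rule locally_bounded_intermediateE)
    obtain r where "r > 0" "closed ((?C1 O ?C2) \<inter> cball (xb, ub) r)"
      by (rule closed_relcomp_near[OF cl Q])
    then show ?thesis
      using assms(6) unfolding locally_closed_at_def gph
      by (intro conjI exI[of _ "cball (xb, ub) r"]) (auto simp: gph centre_in_interior_cball)
  qed
  moreover have "proj_coderiv X S xb ub us \<subseteq>
      (\<Union>wb\<in>?fib. sv_comp (proj_coderiv X S1 xb wb) (coderiv S2 wb ub) us)"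
    if "?lb (xb, ub)" ?cq for us
  proof
    fix t assume "t \<in> proj_coderiv X S xb ub us"
    then have "\<exists>w q. w \<in> ?fib \<and> t \<in> proj_coderiv X S1 xb w q \<and> q \<in> coderiv S2 w ub us"
      using that unfolding assms(1) by (intro proj_coderiv_sv_comp_subset[OF cl]) auto
    then show "t \<in> (\<Union>wb\<in>?fib. sv_comp (proj_coderiv X S1 xb wb) (coderiv S2 wb ub) us)"
      unfolding sv_comp_def by blast
  qed
  moreover have "graph_convex (sv_restrict S X)"
    if "graph_convex (sv_restrict S1 X)" "graph_convex S2"
    using that by (simp add: graph_convex_def gph convex_relcomp)
  moreover have "proj_coderiv X S xb ub = sv_comp (proj_coderiv X S1 xb wb) (coderiv S2 wb ub)"
    if "?lb (xb, ub)" ?cq "graph_convex (sv_restrict S1 X)" "graph_convex S2"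
      "\<exists>d. smooth_manifold_around d X xb" "wb \<in> ?fib" for wb
  proof
    fix us
    obtain d where "smooth_manifold_around d X xb" using \<open>\<exists>d. _\<close> ..
    then show "proj_coderiv X S xb ub us = sv_comp (proj_coderiv X S1 xb wb) (coderiv S2 wb ub) us"
      unfolding assms(1) using proj_coderiv_sv_comp_convex[OF cl] that by auto
  qed
  ultimately show ?thesis by (intro conjI impI allI ballI) (simp_all only:, blast+)
qed

end
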